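(* Let $n\ge 1$, $m>0$, $\varepsilon>0$, and let $\mathcal S=\{S_t\}_{t>0}$ be an approximation of the identity in $\mathbb R^n$ of order $m$ with constant $\varepsilon$, such that $\mathcal S'=\{t\partial_tS_t\}_{t>0}$ satisfies the bounds of order $m$ with constant $\varepsilon$. Let $1<p_1,p_2<\infty$, $q>0$ and $0<\alpha<\min\{1,\varepsilon\}$ be such that $$\frac1q=\frac1{p_1}+\frac1{p_2}-\frac{1-\alpha}{n}.$$ Then there exists a constant $C>0$ such that for every Euclidean ball $B\subset\mathbb R^n$ and all admissible functions $f,g$, $$\Big(\int_B|fg-S_{r(B)^m}(f)\,S_{r(B)^m}(g)|^q\,dx\Big)^{1/q}\le C\,r(B)^\alpha\sum_{l\ge0}2^{-l(\varepsilon-\alpha)}\Big[\Big(\int_{2^{l+1}B}|\nabla f|^{p_1}\Big)^{1/p_1}\Big(\int_{2^{l+1}B}|g|^{p_2}\Big)^{1/p_2}+\Big(\int_{2^{l+1}B}|f|^{p_1}\Big)^{1/p_1}\Big(\int_{2^{l+1}B}|\nabla g|^{p_2}\Big)^{1/p_2}\Big].$$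
   Context: For a ball $B$, $r(B)$ is its radius and $\lambda B$ is the concentric ball of radius $\lambda r(B)$. An approximation of the identity of order $m>0$ in $\mathbb R^n$ with constant $\varepsilon>0$ is a family $\{S_t\}_{t>0}$ of operators $S_tf(x)=\int_{\mathbb R^n}p_t(x,y)f(y)\,dy$ such that for each $t>0$: $\int_{\mathbb R^n}p_t(x,y)\,dy=1$ for all $x$, and $$|p_t(x,y)|\le t^{-n/m}\gamma\big(|x-y|/t^{1/m}\big),\qquad x,y\in\mathbb R^n,\qquad( * )$$ where $\gamma:[0,\infty)\to[0,\infty)$ is bounded, decreasing and $\lim_{r\to\infty}r^{2n+\varepsilon}\gamma(r)=0$. "$\mathcal S'=\{t\partial_tS_t\}_{t>0}$ satisfies the bounds of order $m$ with constant $\varepsilon$" means: $p_t(x,y)$ is differentiable in $t>0$ and the kernels $t\partial_tp_t(x,y)$ of $t\partial_tS_t$ satisfy $( * )$ with the same $m$ and some (possibly different) bounded decreasing $\gamma$ with $\lim_{r\to\infty}r^{2n+\varepsilon}\gamma(r)=0$. Admissible functions: $f,g\in C^1(\mathbb R^n)$ with $\int_{\mathbb R^n}(|f(y)|+|g(y)|)(1+|y|)^{-2n-\varepsilon}dy<\infty$, so that $S_tf,S_tg$ are given by absolutely convergent integrals. *)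

theory Defs
  imports "HOL-Analysis.Analysis"
begin

text \<open>
  Euclidean n-space is a type of class \<^class>\<open>euclidean_space\<close>, with n its \<open>DIM\<close>.
  Scalars lie in a type of sort \<open>{real_normed_field, euclidean_space}\<close>, which has both
  \<^typ>\<open>real\<close> and \<^typ>\<open>complex\<close> as instances.
  A family of kernels \<open>k t x y\<close> is only ever inspected at \<open>t > 0\<close>.
\<close>

definition kernel_bound ::
  "real \<Rightarrow> real \<Rightarrow> (real \<Rightarrow> 'a::euclidean_space \<Rightarrow> 'a \<Rightarrow> 'k::real_normed_vector) \<Rightarrow> bool" where
  "kernel_bound m \<epsilon> k \<longleftrightarrow>
    (\<exists>\<gamma>::real \<Rightarrow> real.
      (\<forall>r\<ge>0. \<gamma> r \<ge> 0) \<and> bounded (\<gamma> ` {0..}) \<and> antimono_on {0..} \<gamma> \<and>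
      ((\<lambda>r. r powr (2 * real DIM('a) + \<epsilon>) * \<gamma> r) \<longlongrightarrow> 0) at_top \<and>
      (\<forall>t>0. \<forall>x y.
        norm (k t x y) \<le> t powr (- real DIM('a) / m) * \<gamma> (norm (x - y) / t powr (1 / m))))"

text \<open>
  Joint measurability of the kernels is not required. Measurability of \<open>p t x\<close> for each \<open>x\<close>
  follows from its integral being 1, as the Bochner integral of a non-integrable function is 0.
\<close>

definition approx_identity ::
  "real \<Rightarrow> real \<Rightarrow>
    (real \<Rightarrow> 'a::euclidean_space \<Rightarrow> 'a \<Rightarrow> 'k::{real_normed_field,euclidean_space}) \<Rightarrow> bool" where
  "approx_identity m \<epsilon> p \<longleftrightarrow>
    kernel_bound m \<epsilon> p \<and> (\<forall>t>0. \<forall>x. integral\<^sup>L lebesgue (p t x) = 1)"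

definition time_derivative_bound ::
  "real \<Rightarrow> real \<Rightarrow>
    (real \<Rightarrow> 'a::euclidean_space \<Rightarrow> 'a \<Rightarrow> 'k::{real_normed_field,euclidean_space}) \<Rightarrow> bool" where
  "time_derivative_bound m \<epsilon> p \<longleftrightarrow>
    (\<forall>t>0. \<forall>x y. (\<lambda>s. p s x y) differentiable (at t)) \<and>
    kernel_bound m \<epsilon> (\<lambda>t x y. t *\<^sub>R vector_derivative (\<lambda>s. p s x y) (at t))"

definition kernel_op ::
  "('a::euclidean_space \<Rightarrow> 'a \<Rightarrow> 'k::{real_normed_field,euclidean_space}) \<Rightarrow>
    ('a \<Rightarrow> 'k) \<Rightarrow> 'a \<Rightarrow> 'k" where
  "kernel_op k f x = (LINT y|lebesgue. k x y * f y)"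

definition C1_fun :: "('a::euclidean_space \<Rightarrow> 'k::real_normed_vector) \<Rightarrow> bool" where
  "C1_fun f \<longleftrightarrow>
    (\<exists>f' :: 'a \<Rightarrow> ('a \<Rightarrow>\<^sub>L 'k).
      (\<forall>x. (f has_derivative blinfun_apply (f' x)) (at x)) \<and> continuous_on UNIV f')"

definition admissible ::
  "real \<Rightarrow> ('a::euclidean_space \<Rightarrow> 'k::real_normed_vector) \<Rightarrow> ('a \<Rightarrow> 'k) \<Rightarrow> bool" where
  "admissible \<epsilon> f g \<longleftrightarrow> C1_fun f \<and> C1_fun g \<and>
    (\<integral>\<^sup>+ y. ennreal ((norm (f y) + norm (g y)) * (1 + norm y) powr (- 2 * real DIM('a) - \<epsilon>))
      \<partial>lebesgue) < \<infinity>"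

text \<open>The Euclidean length of the vector of partial derivatives, in the real and complex case.\<close>

definition grad_norm :: "('a::euclidean_space \<Rightarrow> 'k::real_normed_vector) \<Rightarrow> 'a \<Rightarrow> real" where
  "grad_norm f x = sqrt (\<Sum>b\<in>Basis. (norm (frechet_derivative f (at x) b))\<^sup>2)"

text \<open>
  The (quasi-)norm of \<open>L\<^sup>p(A)\<close> for \<open>0 < p < \<infinity>\<close>. It is \<^typ>\<open>ennreal\<close>-valued, so that
  divergent integrals count as infinite.
\<close>

definition Lp_norm_on ::
  "real \<Rightarrow> 'a::euclidean_space set \<Rightarrow> ('a \<Rightarrow> 'k::real_normed_vector) \<Rightarrow> ennreal" where
  "Lp_norm_on p A f =
    (let I = (\<integral>\<^sup>+ x\<in>A. ennreal (norm (f x) powr p) \<partial>lebesgue)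
     in if I = \<infinity> then \<infinity> else ennreal (enn2real I powr (1 / p)))"

end

theory Submission
  imports Defs
begin

text \<open>
  Write \<open>n\<close> for the dimension and let \<open>S\<^sub>j\<close> be the operator at time \<open>(2\<^sup>-\<^sup>j r)\<^sup>m\<close>. Since
  \<open>S\<^sub>j f \<longlonglongrightarrow> f\<close> pointwise, the product error telescopes into the sum over \<open>j\<close> of
  \<open>S\<^sub>j\<^sub>+\<^sub>1 f S\<^sub>j\<^sub>+\<^sub>1 g - S\<^sub>j f S\<^sub>j g\<close>. The decay of the kernel and the mean value theorem bound
  \<open>|S\<^sub>j f - f|\<close> by \<open>2 powr (- j \<delta>)\<close> times a potential of \<open>|\<nabla>f|\<close>, and \<open>|S\<^sub>j g|\<close> by
  \<open>2 powr (j \<kappa>)\<close> times a potential of \<open>|g|\<close>, both independent of \<open>j\<close>. For \<open>\<kappa> < \<delta>\<close> the series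
  converges. The factor \<open>r powr \<alpha>\<close> leaves room to choose the exponents so that both potentials are
  subcritical: Young's inequality for truncated kernels \<open>|x| powr (- b)\<close> bounds them from
  \<open>L\<^sup>p\<close> to \<open>L\<^sup>q\<close> without Hardy-Littlewood-Sobolev, and the part away from the ball is
  essentially constant on the ball.
\<close>

section \<open>Real powers of extended nonnegative reals and the Hoelder inequality\<close>

text \<open>Split the loss \<open>1 - \<alpha>\<close> as \<open>s1 + s2\<close>, one part per
  factor. The potential of the gradient of \<open>f\<close> has the exponent
  \<open>n + \<delta>1 - 1\<close> near the ball and is subcritical for
  \<open>\<delta>1 < 1 - s1 = s2 + \<alpha>\<close>. That of \<open>g\<close> has the exponent
  \<open>n - \<kappa>2\<close> and is subcritical for \<open>\<kappa>2 > s2\<close>. Summing over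
  scales needs \<open>\<kappa>2 < \<delta>1\<close>. So both numbers must fit into a window of width
  \<open>\<alpha>\<close> above \<open>s2\<close>; the mirrored term gives a window above
  \<open>s1\<close>. Decay of order \<open>2 * n + \<epsilon>\<close> pays for the tails: one power
  goes into the increment of the function, at most \<open>n\<close> into the measure of a dyadic
  ball, and as \<open>n \<ge> 1\<close> a weight \<open>2 powr (- l * \<epsilon>)\<close> survives.
  Each factor brings its own sum over \<open>l\<close>; local norms increase with \<open>l\<close>,
  which reduces the product of two sums to a single one. All norms are
  \<open>ennreal\<close>-valued, so none has to be finite; the price is the product of 0 and
  \<open>top\<close>, which must be treated in the limit of the telescoped sum. Since
  \<open>q\<close> may be smaller than 1, only quasi-norm inequalities are available on the
  left.\<close>

definition ennpowr :: "ennreal \<Rightarrow> real \<Rightarrow> ennreal" where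
  "ennpowr x a = (if x = top then top else ennreal (enn2real x powr a))"

lemma ennpowr_ennreal: "0 \<le> u \<Longrightarrow> ennpowr (ennreal u) a = ennreal (u powr a)"
  by (simp add: ennpowr_def)

lemma ennpowr_0 [simp]: "ennpowr 0 a = 0"
  by (simp add: ennpowr_def)

lemma ennpowr_top [simp]: "ennpowr top a = top"
  by (simp add: ennpowr_def)

lemma ennpowr_1_right [simp]: "ennpowr x 1 = x"
  by (cases x) (auto simp: ennpowr_ennreal)

lemma ennpowr_1_left [simp]: "ennpowr 1 a = 1"
  by (simp add: ennpowr_def)

lemma ennpowr_eq_0_iff [simp]: "ennpowr x a = 0 \<longleftrightarrow> x = 0"
  by (cases x) (auto simp: ennpowr_ennreal)

lemma ennpowr_eq_top_iff [simp]: "ennpowr x a = top \<longleftrightarrow> x = top"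
  by (simp add: ennpowr_def)

lemma ennpowr_mono: "x \<le> y \<Longrightarrow> 0 \<le> a \<Longrightarrow> ennpowr x a \<le> ennpowr y a"
  by (cases x; cases y) (auto simp: ennpowr_ennreal ennreal_le_iff top_unique intro!: powr_mono2)

text \<open>No sign condition on \<open>a\<close>: by convention \<open>ennpowr\<close> keeps 0 and
  \<open>top\<close> fixed for every exponent, including 0 and negative ones, so the power laws
  agree with \<open>0 * top = 0\<close> in all cases.\<close>

lemma ennpowr_mult: "ennpowr (x * y) a = ennpowr x a * ennpowr y a"
  by (cases x; cases y; cases "x = 0"; cases "y = 0")
     (auto simp: ennpowr_ennreal ennreal_mult[symmetric] powr_mult ennreal_mult_top ennreal_top_mult)

lemma ennpowr_add: "ennpowr x (a + b) = ennpowr x a * ennpowr x b"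
  by (cases x) (auto simp: ennpowr_ennreal ennreal_mult[symmetric] powr_add)

lemma ennpowr_ennpowr: "ennpowr (ennpowr x a) b = ennpowr x (a * b)"
  by (cases x) (auto simp: ennpowr_ennreal powr_powr)

lemma ennpowr_measurable [measurable]:
  assumes [measurable]: "f \<in> borel_measurable M"
  shows "(\<lambda>x. ennpowr (f x) a) \<in> borel_measurable M"
  unfolding ennpowr_def by measurable

text \<open>The crude estimate by twice the maximum serves exponents below and above 1 alike, which
  matters because \<open>q\<close> may lie on either side.\<close>

lemma ennpowr_plus_le:
  assumes "0 \<le> a"
  shows "ennpowr (x + y) a \<le> ennreal (2 powr a) * (ennpowr x a + ennpowr y a)"
proof -
  have "ennpowr (x + y) a \<le> ennpowr (2 * max x y) a"
    using assms by (intro ennpowr_mono) (auto simp: mult_2 intro!: add_mono)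
  also have "\<dots> = ennreal (2 powr a) * ennpowr (max x y) a"
    using ennpowr_ennreal[of 2 a] by (simp add: ennpowr_mult)
  also have "\<dots> \<le> ennreal (2 powr a) * (ennpowr x a + ennpowr y a)"
    by (intro mult_left_mono) (auto simp: max_def)
  finally show ?thesis .
qed

text \<open>Pointwise Young inequality, normalised by the two integrals. Weights summing to 1
  replace conjugate exponents, so that the three-factor version follows by nesting.\<close>

lemma nn_integral_Holder:
  assumes [measurable]: "F \<in> borel_measurable M" "G \<in> borel_measurable M"
    and "0 < a" "0 < b" "a + b = 1"
  shows "(\<integral>\<^sup>+ x. ennpowr (F x) a * ennpowr (G x) b \<partial>M)
    \<le> ennpowr (\<integral>\<^sup>+ x. F x \<partial>M) a * ennpowr (\<integral>\<^sup>+ x. G x \<partial>M) b"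
proof -
  \<comment> \<open>A vanishing integral is split off before infinite ones: it makes the right side
    0 even against \<open>top\<close>, and the integrand on the left then vanishes almost
    everywhere.\<close>
  consider "(\<integral>\<^sup>+ x. F x \<partial>M) = 0" | "(\<integral>\<^sup>+ x. G x \<partial>M) = 0"
    | "(\<integral>\<^sup>+ x. F x \<partial>M) \<noteq> 0" "(\<integral>\<^sup>+ x. F x \<partial>M) = top" "(\<integral>\<^sup>+ x. G x \<partial>M) \<noteq> 0"
    | "(\<integral>\<^sup>+ x. G x \<partial>M) \<noteq> 0" "(\<integral>\<^sup>+ x. G x \<partial>M) = top" "(\<integral>\<^sup>+ x. F x \<partial>M) \<noteq> 0"
    | u v where "0 < u" "0 < v" "(\<integral>\<^sup>+ x. F x \<partial>M) = ennreal u" "(\<integral>\<^sup>+ x. G x \<partial>M) = ennreal v"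
    by (cases "(\<integral>\<^sup>+ x. F x \<partial>M)"; cases "(\<integral>\<^sup>+ x. G x \<partial>M)") (force simp: top_unique less_le)+
  then show ?thesis
  proof cases
    case 1
    then have "AE x in M. ennpowr (F x) a * ennpowr (G x) b = 0"
      by (auto simp: nn_integral_0_iff_AE)
    then have "(\<integral>\<^sup>+ x. ennpowr (F x) a * ennpowr (G x) b \<partial>M) = 0"
      by (simp add: nn_integral_0_iff_AE)
    then show ?thesis by simp
  next
    case 2
    then have "AE x in M. ennpowr (F x) a * ennpowr (G x) b = 0"
      by (auto simp: nn_integral_0_iff_AE)
    then have "(\<integral>\<^sup>+ x. ennpowr (F x) a * ennpowr (G x) b \<partial>M) = 0"
      by (simp add: nn_integral_0_iff_AE)
    then show ?thesis by simp
  next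
    case 3
    then show ?thesis by (simp add: ennreal_top_mult)
  next
    case 4
    then show ?thesis by (simp add: ennreal_mult_top)
  next
    case (5 u v)
    \<comment> \<open>The bracket on the right integrates to \<open>a + b = 1\<close>, which leaves
      exactly the asserted constant.\<close>
    have young: "ennpowr s a * ennpowr t b
        \<le> ennreal (u powr a * v powr b) * (ennreal (a / u) * s + ennreal (b / v) * t)" for s t
    proof (cases s; cases t)
      fix s' t' assume st: "0 \<le> s'" "s = ennreal s'" "0 \<le> t'" "t = ennreal t'"
      have "(s' / u) powr a * (t' / v) powr b \<le> a * (s' / u) + b * (t' / v)"
        using Youngs_inequality_0[of a b "s' / u" "t' / v"] assms 5 st
        by (cases "s' = 0 \<or> t' = 0") auto
      then have "u powr a * v powr b * ((s' / u) powr a * (t' / v) powr b)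
          \<le> u powr a * v powr b * (a * (s' / u) + b * (t' / v))"
        by (intro mult_left_mono) auto
      also have "u powr a * v powr b * ((s' / u) powr a * (t' / v) powr b) = s' powr a * t' powr b"
        using 5 st by (simp add: powr_divide)
      finally show ?thesis
        using 5 assms st
        by (simp add: ennpowr_ennreal ennreal_mult[symmetric] ennreal_plus[symmetric] ennreal_leI
            del: ennreal_plus)
    qed (use 5 assms in \<open>auto simp: ennreal_mult_top ennreal_mult_eq_top_iff top_unique\<close>)
    have "(\<integral>\<^sup>+ x. ennpowr (F x) a * ennpowr (G x) b \<partial>M)
      \<le> (\<integral>\<^sup>+ x. ennreal (u powr a * v powr b) * (ennreal (a / u) * F x + ennreal (b / v) * G x) \<partial>M)"
      by (intro nn_integral_mono young)
    also have "\<dots> = ennreal (u powr a * v powr b) * (ennreal (a / u) * ennreal u + ennreal (b / v) * ennreal v)"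
      using 5 by (simp add: nn_integral_cmult nn_integral_add)
    also have "ennreal (a / u) * ennreal u + ennreal (b / v) * ennreal v = 1"
      using 5 assms by (simp add: ennreal_mult[symmetric] ennreal_plus[symmetric] del: ennreal_plus)
    finally show ?thesis
      using 5 by (simp add: ennpowr_ennreal ennreal_mult)
  qed
qed

lemma nn_integral_Holder3:
  assumes [measurable]: "F \<in> borel_measurable M" "G \<in> borel_measurable M" "H \<in> borel_measurable M"
    and "0 < a" "0 < b" "0 < c" "a + b + c = 1"
  shows "(\<integral>\<^sup>+ x. ennpowr (F x) a * ennpowr (G x) b * ennpowr (H x) c \<partial>M)
    \<le> ennpowr (\<integral>\<^sup>+ x. F x \<partial>M) a * ennpowr (\<integral>\<^sup>+ x. G x \<partial>M) b * ennpowr (\<integral>\<^sup>+ x. H x \<partial>M) c"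
proof -
  define e where "e = b + c"
  have e: "0 < e" "a + e = 1" "b / e + c / e = 1"
    using assms by (auto simp: e_def add_divide_distrib[symmetric])
  have "(\<integral>\<^sup>+ x. ennpowr (F x) a * ennpowr (G x) b * ennpowr (H x) c \<partial>M)
    = (\<integral>\<^sup>+ x. ennpowr (F x) a * ennpowr (ennpowr (G x) (b / e) * ennpowr (H x) (c / e)) e \<partial>M)"
    using e by (simp add: ennpowr_mult ennpowr_ennpowr mult.assoc)
  also have "\<dots> \<le> ennpowr (\<integral>\<^sup>+ x. F x \<partial>M) a
      * ennpowr (\<integral>\<^sup>+ x. ennpowr (G x) (b / e) * ennpowr (H x) (c / e) \<partial>M) e"
    using e assms by (intro nn_integral_Holder) auto
  also have "\<dots> \<le> ennpowr (\<integral>\<^sup>+ x. F x \<partial>M) a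
      * ennpowr (ennpowr (\<integral>\<^sup>+ x. G x \<partial>M) (b / e) * ennpowr (\<integral>\<^sup>+ x. H x \<partial>M) (c / e)) e"
    using e assms by (intro mult_left_mono ennpowr_mono nn_integral_Holder) auto
  also have "\<dots> = ennpowr (\<integral>\<^sup>+ x. F x \<partial>M) a * ennpowr (\<integral>\<^sup>+ x. G x \<partial>M) b * ennpowr (\<integral>\<^sup>+ x. H x \<partial>M) c"
    using e by (simp add: ennpowr_mult ennpowr_ennpowr mult.assoc)
  finally show ?thesis .
qed

section \<open>Lebesgue norms of extended nonnegative functions\<close>

lemma ennreal_le_suminf: "f k \<le> (\<Sum>i. f i)" for f :: "nat \<Rightarrow> ennreal"
  using sum_le_suminf[of f "{k}"] by simp

text \<open>The measure is \<open>lborel\<close> because Fubini and affine substitution are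
  available there. The passage from \<open>lebesgue\<close> happens only in
  \<open>Lp_norm_on_eq_enn_Lp\<close>.\<close>

definition enn_Lp :: "real \<Rightarrow> 'a::euclidean_space set \<Rightarrow> ('a \<Rightarrow> ennreal) \<Rightarrow> ennreal" where
  "enn_Lp p A h = ennpowr (\<integral>\<^sup>+ x\<in>A. ennpowr (h x) p \<partial>lborel) (1 / p)"

lemma enn_Lp_mono:
  assumes "0 < p" "A \<subseteq> B" "\<And>x. x \<in> A \<Longrightarrow> f x \<le> g x"
  shows "enn_Lp p A f \<le> enn_Lp p B g"
  unfolding enn_Lp_def using assms
  by (intro ennpowr_mono nn_integral_mono) (auto simp: indicator_def intro!: ennpowr_mono)

lemma enn_Lp_cmult:
  assumes "0 < p" and [measurable]: "A \<in> sets borel" "f \<in> borel_measurable borel"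
  shows "enn_Lp p A (\<lambda>x. c * f x) = c * enn_Lp p A f"
  using assms unfolding enn_Lp_def
  by (simp add: ennpowr_mult mult.assoc nn_integral_cmult ennpowr_ennpowr)

lemma enn_Lp_const:
  assumes "0 < p" and "A \<in> sets borel"
  shows "enn_Lp p A (\<lambda>x. c) = c * ennpowr (emeasure lborel A) (1 / p)"
  using assms unfolding enn_Lp_def
  by (simp add: nn_integral_cmult_indicator ennpowr_mult ennpowr_ennpowr)

lemma enn_Lp_add_le:
  assumes "0 < p" and [measurable]: "A \<in> sets borel" "f \<in> borel_measurable borel" "g \<in> borel_measurable borel"
  shows "enn_Lp p A (\<lambda>x. f x + g x) \<le> ennreal (2 powr (1 + 1 / p)) * (enn_Lp p A f + enn_Lp p A g)"
proof -
  have "(\<integral>\<^sup>+ x\<in>A. ennpowr (f x + g x) p \<partial>lborel)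
    \<le> (\<integral>\<^sup>+ x. ennreal (2 powr p) * (ennpowr (f x) p * indicator A x + ennpowr (g x) p * indicator A x) \<partial>lborel)"
    using assms by (intro nn_integral_mono) (auto simp: indicator_def intro!: ennpowr_plus_le)
  also have "\<dots> = ennreal (2 powr p) * ((\<integral>\<^sup>+ x\<in>A. ennpowr (f x) p \<partial>lborel) + (\<integral>\<^sup>+ x\<in>A. ennpowr (g x) p \<partial>lborel))"
    by (simp add: nn_integral_cmult nn_integral_add)
  finally have "enn_Lp p A (\<lambda>x. f x + g x) \<le> ennpowr (ennreal (2 powr p) *
      ((\<integral>\<^sup>+ x\<in>A. ennpowr (f x) p \<partial>lborel) + (\<integral>\<^sup>+ x\<in>A. ennpowr (g x) p \<partial>lborel))) (1 / p)"
    unfolding enn_Lp_def using assms by (intro ennpowr_mono) auto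
  also have "\<dots> = 2 * ennpowr
      ((\<integral>\<^sup>+ x\<in>A. ennpowr (f x) p \<partial>lborel) + (\<integral>\<^sup>+ x\<in>A. ennpowr (g x) p \<partial>lborel)) (1 / p)"
    using assms by (simp add: ennpowr_mult ennpowr_ennreal powr_powr)
  also have "\<dots> \<le> 2 * (ennreal (2 powr (1 / p)) * (enn_Lp p A f + enn_Lp p A g))"
    unfolding enn_Lp_def using assms by (intro mult_left_mono ennpowr_plus_le) auto
  also have "\<dots> = ennreal (2 powr (1 + 1 / p)) * (enn_Lp p A f + enn_Lp p A g)"
    by (simp add: powr_add ennreal_mult mult.assoc)
  finally show ?thesis .
qed

lemma enn_Lp_mult_le:
  assumes "0 < q" "0 < q1" "0 < q2" "1 / q = 1 / q1 + 1 / q2"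
    and [measurable]: "A \<in> sets borel" "f \<in> borel_measurable borel" "g \<in> borel_measurable borel"
  shows "enn_Lp q A (\<lambda>x. f x * g x) \<le> enn_Lp q1 A f * enn_Lp q2 A g"
proof -
  have e: "q / q1 + q / q2 = 1" "0 < q / q1" "0 < q / q2"
    using assms by (auto simp: divide_simps) (auto simp: algebra_simps)
  have "(\<integral>\<^sup>+ x\<in>A. ennpowr (f x * g x) q \<partial>lborel)
    = (\<integral>\<^sup>+ x. ennpowr (ennpowr (f x) q1 * indicator A x) (q / q1) *
        ennpowr (ennpowr (g x) q2 * indicator A x) (q / q2) \<partial>lborel)"
    using assms by (intro nn_integral_cong)
      (auto simp: ennpowr_mult ennpowr_ennpowr indicator_def)
  also have "\<dots> \<le> ennpowr (\<integral>\<^sup>+ x\<in>A. ennpowr (f x) q1 \<partial>lborel) (q / q1) *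
      ennpowr (\<integral>\<^sup>+ x\<in>A. ennpowr (g x) q2 \<partial>lborel) (q / q2)"
    using e by (intro nn_integral_Holder) auto
  finally have "enn_Lp q A (\<lambda>x. f x * g x) \<le> ennpowr (ennpowr (\<integral>\<^sup>+ x\<in>A. ennpowr (f x) q1 \<partial>lborel) (q / q1) *
      ennpowr (\<integral>\<^sup>+ x\<in>A. ennpowr (g x) q2 \<partial>lborel) (q / q2)) (1 / q)"
    unfolding enn_Lp_def using assms by (intro ennpowr_mono) auto
  moreover have "q / q1 * (1 / q) = 1 / q1" "q / q2 * (1 / q) = 1 / q2"
    using \<open>0 < q\<close> by auto
  ultimately show ?thesis
    unfolding enn_Lp_def ennpowr_mult ennpowr_ennpowr by simp
qed

text \<open>Hoelder against the constant 1, whose exponent \<open>1 / (1 - 1 / p)\<close> is the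
  conjugate of \<open>p\<close>.\<close>

lemma nn_integral_le_enn_Lp:
  assumes "1 < p" and [measurable]: "A \<in> sets borel" "h \<in> borel_measurable borel"
  shows "(\<integral>\<^sup>+ x\<in>A. h x \<partial>lborel) \<le> ennpowr (emeasure lborel A) (1 - 1 / p) * enn_Lp p A h"
proof -
  have "enn_Lp 1 A (\<lambda>x. 1 * h x) \<le> enn_Lp (1 / (1 - 1 / p)) A (\<lambda>_. 1) * enn_Lp p A h"
    using assms by (intro enn_Lp_mult_le) (auto simp: divide_simps)
  also have "enn_Lp (1 / (1 - 1 / p)) A (\<lambda>_. 1) = ennpowr (emeasure lborel A) (1 - 1 / p)"
    using assms by (subst enn_Lp_const) (auto simp: divide_simps)
  finally show ?thesis by (simp add: enn_Lp_def)
qed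

lemma nn_integral_lborel_affine:
  fixes f :: "'a::euclidean_space \<Rightarrow> ennreal"
  assumes "c \<noteq> 0" and [measurable]: "f \<in> borel_measurable borel"
  shows "(\<integral>\<^sup>+ x. f x \<partial>lborel) = (\<integral>\<^sup>+ x. ennreal (\<bar>c\<bar> ^ DIM('a)) * f (t + c *\<^sub>R x) \<partial>lborel)"
  by (subst lborel_affine[OF \<open>c \<noteq> 0\<close>, of t])
     (simp add: nn_integral_density nn_integral_distr)

lemma nn_integral_lborel_reflect:
  fixes f :: "'a::euclidean_space \<Rightarrow> ennreal"
  assumes [measurable]: "f \<in> borel_measurable borel"
  shows "(\<integral>\<^sup>+ x. f (t - x) \<partial>lborel) = (\<integral>\<^sup>+ x. f x \<partial>lborel)"
  using nn_integral_lborel_affine[of "-1" f t] by simp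

lemma nn_integral_lborel_translate:
  fixes f :: "'a::euclidean_space \<Rightarrow> ennreal"
  assumes [measurable]: "f \<in> borel_measurable borel"
  shows "(\<integral>\<^sup>+ x. f (t + x) \<partial>lborel) = (\<integral>\<^sup>+ x. f x \<partial>lborel)"
  using nn_integral_lborel_affine[of "1" f t] by simp

text \<open>On the shell \<open>R / 2 ^ Suc k \<le> norm u < R / 2 ^ k\<close> the integrand is at
  most \<open>c k\<close>. Enlarging shells to balls keeps the sum geometric, with ratio
  \<open>(1/2) powr (n - \<beta>)\<close>, which is below 1 exactly because
  \<open>\<beta> < n\<close>.\<close>

lemma nn_integral_norm_powr_ball:
  fixes \<beta> :: real
  assumes "0 \<le> \<beta>" "\<beta> < real DIM('a::euclidean_space)"
  shows "\<exists>C>0. \<forall>R>0. (\<integral>\<^sup>+ u\<in>ball (0::'a) R. ennreal (norm u powr - \<beta>) \<partial>lborel)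
    \<le> ennreal (C * R powr (DIM('a) - \<beta>))"
proof -
  define n where "n = real DIM('a)"
  define w where "w = unit_ball_vol n"
  define x where "x = (1/2) powr (n - \<beta>)"
  have w: "w > 0" by (simp add: w_def n_def)
  have x: "0 < x" "x < 1"
    using assms powr_less_mono2[of "n - \<beta>" "1/2" 1] by (auto simp: x_def n_def)
  define C where "C = w * 2 powr \<beta> * (1 / (1 - x))"
  have "(\<integral>\<^sup>+ u\<in>ball (0::'a) R. ennreal (norm u powr - \<beta>) \<partial>lborel) \<le> ennreal (C * R powr (n - \<beta>))"
    if R: "R > 0" for R
  proof -
    define c where "c k = (R / 2 ^ Suc k) powr - \<beta>" for k
    have pt: "ennreal (norm u powr - \<beta>) * indicator (ball 0 R) u
        \<le> (\<Sum>k. ennreal (c k) * indicator (ball 0 (R / 2 ^ k)) u)" for u :: 'a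
    \<comment> \<open>At the origin the left side is 0, since \<open>0 powr - \<beta>\<close> is 0
      by convention; every other point of the ball lies in one of the shells.\<close>
    proof (cases "u \<noteq> 0 \<and> norm u < R")
      case True
      have "(\<lambda>k. R / 2 ^ k) \<longlonglongrightarrow> 0"
        by (intro LIMSEQ_divide_realpow_zero) auto
      then have "eventually (\<lambda>k. R / 2 ^ k < norm u) sequentially"
        using True by (intro order_tendstoD) auto
      then obtain k0 where "R / 2 ^ k0 < norm u" by (auto simp: eventually_sequentially)
      then have ex: "\<exists>k. R / 2 ^ k \<le> norm u" by (auto intro: less_imp_le)
      define j where "j = (LEAST k. R / 2 ^ k \<le> norm u)"
      have j: "R / 2 ^ j \<le> norm u" unfolding j_def using ex by (rule LeastI_ex)
      have "j \<noteq> 0" using j True by (cases j) auto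
      then obtain k where k: "j = Suc k" by (cases j) auto
      have "\<not> R / 2 ^ k \<le> norm u"
        using k not_less_Least[of k "\<lambda>k. R / 2 ^ k \<le> norm u"] by (auto simp: j_def)
      then have "u \<in> ball 0 (R / 2 ^ k)" by auto
      moreover have "norm u powr - \<beta> \<le> c k"
        unfolding c_def using j k R assms by (intro powr_mono2') auto
      ultimately have "ennreal (norm u powr - \<beta>) * indicator (ball 0 R) u
          \<le> ennreal (c k) * indicator (ball 0 (R / 2 ^ k)) u"
        using True by (auto simp: ennreal_leI)
      also have "\<dots> \<le> (\<Sum>k. ennreal (c k) * indicator (ball 0 (R / 2 ^ k)) u)"
        by (rule ennreal_le_suminf)
      finally show ?thesis .
    qed (auto simp: indicator_def)
    have eq: "c k * (w * (R / 2 ^ k) ^ DIM('a)) = w * 2 powr \<beta> * R powr (n - \<beta>) * x ^ k" for k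
    proof -
      have 1: "(R / 2 ^ k) ^ DIM('a) = (R / 2 ^ k) powr n"
        using R by (simp add: n_def powr_realpow)
      have 2: "c k = 2 powr \<beta> * (R / 2 ^ k) powr - \<beta>"
        using R by (simp add: c_def powr_divide powr_mult powr_minus field_simps)
      have 3: "(R / 2 ^ k) powr - \<beta> * (R / 2 ^ k) powr n = (R / 2 ^ k) powr (n - \<beta>)"
        by (simp add: powr_add[symmetric])
      have "x ^ k = (1 / 2 ^ k) powr (n - \<beta>)"
      proof -
        have "x ^ k = x powr real k" using x by (simp add: powr_realpow)
        also have "\<dots> = ((1/2) powr real k) powr (n - \<beta>)"
          by (simp only: x_def powr_powr mult.commute)
        finally show ?thesis by (simp add: powr_realpow power_divide)
      qed
      then have 4: "(R / 2 ^ k) powr (n - \<beta>) = R powr (n - \<beta>) * x ^ k"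
        using R by (simp add: powr_divide)
      show ?thesis
        unfolding 1 2 using 3 4 by (simp add: mult_ac)
    qed
    have meas: "(\<lambda>u. ennreal (c k) * indicator (ball (0::'a) (R / 2 ^ k)) u) \<in> borel_measurable lborel" for k
      by (intro borel_measurable_times_ennreal borel_measurable_indicator) auto
    have ball: "(\<integral>\<^sup>+ u. ennreal (c k) * indicator (ball (0::'a) (R / 2 ^ k)) u \<partial>lborel)
        = ennreal (c k) * emeasure lborel (ball (0::'a) (R / 2 ^ k))" for k
      by (rule nn_integral_cmult_indicator) simp
    have "(\<integral>\<^sup>+ u\<in>ball (0::'a) R. ennreal (norm u powr - \<beta>) \<partial>lborel)
      \<le> (\<integral>\<^sup>+ u. (\<Sum>k. ennreal (c k) * indicator (ball (0::'a) (R / 2 ^ k)) u) \<partial>lborel)"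
      by (intro nn_integral_mono pt)
    also have "\<dots> = (\<Sum>k. ennreal (c k) * emeasure lborel (ball (0::'a) (R / 2 ^ k)))"
      by (subst nn_integral_suminf[OF meas]) (simp only: ball)
    also have "\<dots> = (\<Sum>k. ennreal (w * 2 powr \<beta> * R powr (n - \<beta>) * x ^ k))"
    proof (intro suminf_cong)
      fix k
      have "emeasure lborel (ball (0::'a) (R / 2 ^ k)) = ennreal (w * (R / 2 ^ k) ^ DIM('a))"
        using R by (simp add: emeasure_ball w_def n_def)
      then show "ennreal (c k) * emeasure lborel (ball (0::'a) (R / 2 ^ k))
          = ennreal (w * 2 powr \<beta> * R powr (n - \<beta>) * x ^ k)"
        unfolding eq[symmetric] using R w by (simp add: ennreal_mult[symmetric] c_def)
    qed
    also have "\<dots> = ennreal (\<Sum>k. w * 2 powr \<beta> * R powr (n - \<beta>) * x ^ k)"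
      using w x by (intro suminf_ennreal2) auto
    also have "(\<Sum>k. w * 2 powr \<beta> * R powr (n - \<beta>) * x ^ k) = C * R powr (n - \<beta>)"
      using x by (simp add: suminf_mult suminf_geometric C_def)
    finally show ?thesis .
  qed
  moreover have "C > 0" using w x by (simp add: C_def)
  ultimately show ?thesis unfolding n_def by blast
qed

section \<open>Potential estimates\<close>

text \<open>Young's convolution inequality for the kernel \<open>norm u powr - b\<close> cut off at
  radius \<open>3 * r\<close>. The strict inequality \<open>b < n - s\<close> says that this kernel
  has a finite norm of exponent \<open>n / (n - s)\<close>.\<close>

lemma Riesz_potential_Lp:
  fixes p q s b :: real
  assumes "1 < p" "0 < q" "0 < s" "1 / q = 1 / p - s / DIM('a::euclidean_space)"
    and "0 \<le> b" "b < DIM('a) - s"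
  shows "\<exists>C>0. \<forall>(z::'a) r (h::'a \<Rightarrow> ennreal). r > 0 \<longrightarrow> h \<in> borel_measurable borel \<longrightarrow>
    enn_Lp q (ball z r) (\<lambda>x. \<integral>\<^sup>+ y\<in>ball z (2 * r). ennreal (norm (x - y) powr - b) * h y \<partial>lborel)
    \<le> ennreal (C * r powr (DIM('a) - s - b)) * enn_Lp p (ball z (2 * r)) h"
proof -
  define n where "n = real DIM('a)"
  \<comment> \<open>Young's relation \<open>1 + 1 / q = 1 / p + 1 / k\<close> forces this
    exponent.\<close>
  define k where "k = n / (n - s)"
  have n: "n > 0" by (simp add: n_def)
  have sn: "s < n" using assms by (simp add: n_def)
  have k: "k > 0" "1 / k = 1 - s / n" using n sn by (auto simp: k_def divide_simps)
  have "0 < 1 / q" using \<open>0 < q\<close> by simp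
  then have sp: "1 / q = 1 / p - s / n" "s / n < 1 / p"
    unfolding assms(4) by (auto simp: n_def)
  have e: "1 / q + (1 - 1 / p) + s / n = 1" "0 < 1 / q" "0 < 1 - 1 / p" "0 < s / n"
    subgoal using sp by linarith
    subgoal using \<open>0 < q\<close> by simp
    subgoal using \<open>1 < p\<close> by simp
    subgoal using \<open>0 < s\<close> n by simp
    done
  have bk: "b * k < n"
    using mult_strict_right_mono[of b "n - s" n] assms n sn
    unfolding k_def n_def by (simp add: pos_divide_less_eq)
  obtain C0 where C0: "C0 > 0" "\<And>R. R > 0 \<Longrightarrow> (\<integral>\<^sup>+ u\<in>ball (0::'a) R. ennreal (norm u powr - (b * k)) \<partial>lborel)
    \<le> ennreal (C0 * R powr (n - b * k))"
    using nn_integral_norm_powr_ball[where 'a='a, of "b * k"] assms k bk unfolding n_def by auto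
  define C where "C = (C0 * 3 powr (n - b * k)) powr (1 / k)"
  have main: "enn_Lp q (ball z r) (\<lambda>x. \<integral>\<^sup>+ y\<in>ball z (2 * r). ennreal (norm (x - y) powr - b) * h y \<partial>lborel)
    \<le> ennreal (C * r powr (n - s - b)) * enn_Lp p (ball z (2 * r)) h"
    if r: "r > 0" and [measurable]: "h \<in> borel_measurable borel" for z :: 'a and r and h :: "'a \<Rightarrow> ennreal"
  proof -
    \<comment> \<open>\<open>K\<close> is the \<open>k\<close>-th power of the truncated kernel and
      \<open>H\<close> the \<open>p\<close>-th power of the truncated function. The radius
      \<open>3 * r\<close> covers all differences between points of the ball and points of its
      double.\<close>
    define K where "K u = ennreal (norm u powr - (b * k)) * indicator (ball 0 (3 * r)) u" for u :: 'a
    define H where "H y = ennpowr (h y) p * indicator (ball z (2 * r)) y" for y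
    have [measurable]: "K \<in> borel_measurable borel" "H \<in> borel_measurable borel"
      unfolding K_def[abs_def] H_def[abs_def]
      by (intro borel_measurable_times_ennreal borel_measurable_indicator; auto)+
    define J where "J = (\<integral>\<^sup>+ u. K u \<partial>lborel)"
    define N where "N = (\<integral>\<^sup>+ y. H y \<partial>lborel)"
    have J: "J \<le> ennreal (C0 * (3 * r) powr (n - b * k))"
      unfolding J_def K_def using r by (intro C0) auto
    have KJ: "(\<integral>\<^sup>+ y. K (x - y) \<partial>lborel) = J" "(\<integral>\<^sup>+ y. K (y - x) \<partial>lborel) = J" for x
      using nn_integral_lborel_reflect[of K x] nn_integral_lborel_translate[of K "- x"]
      by (auto simp: J_def algebra_simps)
    have pw: "(\<integral>\<^sup>+ y\<in>ball z (2 * r). ennreal (norm (x - y) powr - b) * h y \<partial>lborel)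
      \<le> ennpowr (\<integral>\<^sup>+ y. K (x - y) * H y \<partial>lborel) (1 / q) * ennpowr J (1 - 1 / p) * ennpowr N (s / n)"
      if x: "x \<in> ball z r" for x
    proof -
      \<comment> \<open>The factorisation behind Young's inequality: the exponents of
        \<open>K\<close> add up to \<open>1 / k\<close> and those of \<open>H\<close> to
        \<open>1 / p\<close>. Only the first of the three factors couples \<open>x\<close> and
        \<open>y\<close> after integration in \<open>y\<close>.\<close>
      have "ennreal (norm (x - y) powr - b) * h y
        = ennpowr (K (x - y) * H y) (1 / q) * ennpowr (K (x - y)) (1 - 1 / p) * ennpowr (H y) (s / n)"
        if y: "y \<in> ball z (2 * r)" for y
      proof -
        have "dist x y < 3 * r"
          using x y dist_triangle[of x y z] by (simp add: dist_commute)
        then have "x - y \<in> ball 0 (3 * r)" unfolding mem_ball_0 dist_norm .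
        then have K1: "K (x - y) = ennreal (norm (x - y) powr - (b * k))"
          by (simp add: K_def del: mem_ball_0)
        have H1: "H y = ennpowr (h y) p" using y by (simp add: H_def)
        have "ennpowr (K (x - y) * H y) (1 / q) * ennpowr (K (x - y)) (1 - 1 / p) * ennpowr (H y) (s / n)
          = ennpowr (K (x - y)) (1 / q + (1 - 1 / p)) * ennpowr (H y) (1 / q + s / n)"
          by (simp only: ennpowr_mult ennpowr_add mult_ac)
        moreover have "1 / q + (1 - 1 / p) = 1 / k" "1 / q + s / n = 1 / p"
          using e k by auto
        moreover have "ennpowr (H y) (1 / p) = h y"
          using assms by (simp add: H1 ennpowr_ennpowr)
        moreover have "ennpowr (K (x - y)) (1 / k) = ennreal (norm (x - y) powr - b)"
          using k(1) by (simp add: K1 ennpowr_ennreal powr_powr)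
        ultimately show ?thesis by simp
      qed
      then have "(\<integral>\<^sup>+ y\<in>ball z (2 * r). ennreal (norm (x - y) powr - b) * h y \<partial>lborel)
        \<le> (\<integral>\<^sup>+ y. ennpowr (K (x - y) * H y) (1 / q) * ennpowr (K (x - y)) (1 - 1 / p) * ennpowr (H y) (s / n) \<partial>lborel)"
        by (intro nn_integral_mono) (auto simp: indicator_def)
      also have "\<dots> \<le> ennpowr (\<integral>\<^sup>+ y. K (x - y) * H y \<partial>lborel) (1 / q)
          * ennpowr (\<integral>\<^sup>+ y. K (x - y) \<partial>lborel) (1 - 1 / p) * ennpowr (\<integral>\<^sup>+ y. H y \<partial>lborel) (s / n)"
        using e by (intro nn_integral_Holder3) auto
      finally show ?thesis unfolding KJ N_def .
    qed
    define D where "D = ennpowr J (1 - 1 / p) * ennpowr N (s / n)"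
    have "(\<integral>\<^sup>+ x. (\<integral>\<^sup>+ y. K (x - y) * H y \<partial>lborel) \<partial>lborel)
        = (\<integral>\<^sup>+ y. (\<integral>\<^sup>+ x. K (x - y) * H y \<partial>lborel) \<partial>lborel)"
      by (rule lborel_pair.Fubini') measurable
    also have "\<dots> = J * N"
      by (simp add: nn_integral_multc nn_integral_cmult KJ N_def)
    finally have JN: "(\<integral>\<^sup>+ x. (\<integral>\<^sup>+ y. K (x - y) * H y \<partial>lborel) \<partial>lborel) = J * N" .
    have "enn_Lp q (ball z r) (\<lambda>x. \<integral>\<^sup>+ y\<in>ball z (2 * r). ennreal (norm (x - y) powr - b) * h y \<partial>lborel)
      \<le> enn_Lp q UNIV (\<lambda>x. D * ennpowr (\<integral>\<^sup>+ y. K (x - y) * H y \<partial>lborel) (1 / q))"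
      using assms pw by (intro enn_Lp_mono) (auto simp: D_def mult_ac)
    also have "\<dots> = D * enn_Lp q UNIV (\<lambda>x. ennpowr (\<integral>\<^sup>+ y. K (x - y) * H y \<partial>lborel) (1 / q))"
      using assms by (intro enn_Lp_cmult) auto
    also have "enn_Lp q UNIV (\<lambda>x. ennpowr (\<integral>\<^sup>+ y. K (x - y) * H y \<partial>lborel) (1 / q)) = ennpowr (J * N) (1 / q)"
      using \<open>0 < q\<close> JN by (simp add: enn_Lp_def ennpowr_ennpowr)
    also have "D * ennpowr (J * N) (1 / q)
      = ennpowr J (1 / q + (1 - 1 / p)) * ennpowr N (1 / q + s / n)"
      by (simp only: D_def ennpowr_mult ennpowr_add mult_ac)
    also have "1 / q + (1 - 1 / p) = 1 / k" using e k by auto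
    also have "1 / q + s / n = 1 / p" using e by auto
    also have "ennpowr N (1 / p) = enn_Lp p (ball z (2 * r)) h"
      by (simp add: N_def H_def enn_Lp_def)
    also have "ennpowr J (1 / k) \<le> ennpowr (ennreal (C0 * (3 * r) powr (n - b * k))) (1 / k)"
      using J k(1) by (intro ennpowr_mono) auto
    also have "\<dots> = ennreal (C * r powr (n - s - b))"
    proof -
      have "(n - b * k) * (1 / k) = n * (1 / k) - b" using k(1) by (simp add: field_simps)
      also have "\<dots> = n - s - b" unfolding k(2) using n by (simp add: field_simps)
      finally have "(r powr (n - b * k)) powr (1 / k) = r powr (n - s - b)"
        unfolding powr_powr by simp
      then show ?thesis
        using C0 r by (simp add: ennpowr_ennreal C_def powr_mult mult_ac)
    qed
    finally show ?thesis by (simp add: mult_right_mono)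
  qed
  have "C > 0" using C0 by (simp add: C_def)
  then show ?thesis using main unfolding n_def by blast
qed

text \<open>
  The kernel is a power of \<open>|x - y| / r\<close> whose exponent is tuned for integrability near the ball
  and for decay away from it.
\<close>

definition potential ::
  "real \<Rightarrow> real \<Rightarrow> 'a::euclidean_space \<Rightarrow> real \<Rightarrow> ('a \<Rightarrow> ennreal) \<Rightarrow> 'a \<Rightarrow> ennreal" where
  "potential b c z r h x =
    (\<integral>\<^sup>+ y. ennreal ((norm (x - y) / r) powr (- (if y \<in> ball z (2 * r) then b else c))) * h y \<partial>lborel)"

lemma potential_measurable [measurable]:
  assumes [measurable]: "h \<in> borel_measurable borel"
  shows "potential b c z r h \<in> borel_measurable borel"
proof -
  have [measurable]: "h \<in> borel_measurable lborel" by simp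
  show ?thesis
    unfolding potential_def[abs_def] mem_ball by measurable
qed

lemma ennreal_mult_mult_right_mono:
  assumes "a * b \<le> c * d" "0 \<le> a" "0 \<le> b" "0 \<le> c" "0 \<le> d"
  shows "ennreal a * (ennreal b * X) \<le> ennreal c * (ennreal d * X)"
  unfolding mult.assoc[symmetric] using assms
  by (intro mult_right_mono) (simp_all add: ennreal_mult[symmetric] ennreal_leI)

text \<open>Cover the complement of the doubled ball by dyadic shells, bound the kernel by a
  constant on each, and apply Hoelder on the surrounding ball. The bound is the same for all
  \<open>x\<close> in the ball, which makes the far part essentially constant there.\<close>

lemma potential_tail_le:
  fixes z :: "'a::euclidean_space" and p \<epsilon> c :: real
  assumes r: "r > 0" and "1 < p" and "0 < \<epsilon>" "DIM('a) + \<epsilon> \<le> c"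
    and x: "x \<in> ball z r" and [measurable]: "h \<in> borel_measurable borel"
  shows "(\<integral>\<^sup>+ y\<in>- ball z (2 * r). ennreal ((norm (x - y) / r) powr - c) * h y \<partial>lborel)
    \<le> ennreal (4 ^ DIM('a) * 2 powr \<epsilon> * (unit_ball_vol DIM('a) * r ^ DIM('a)) powr (1 - 1 / p)) *
      (\<Sum>l. ennreal (2 powr (- real l * \<epsilon>)) * enn_Lp p (ball z (2 ^ (l + 1) * r)) h)"
proof -
  define n where "n = real DIM('a)"
  define w where "w = unit_ball_vol n * r ^ DIM('a)"
  have w: "w > 0" using r by (simp add: w_def n_def)
  define X where "X l = enn_Lp p (ball z (2 ^ (l + 1) * r)) h" for l
  define Q where "Q = 4 ^ DIM('a) * 2 powr \<epsilon> * w powr (1 - 1 / p)"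
  have pt: "ennreal ((norm (x - y) / r) powr - c) * h y * indicator (- ball z (2 * r)) y
    \<le> (\<Sum>k. ennreal ((2 ^ k) powr - c) * (h y * indicator (ball z (2 ^ (k + 2) * r)) y))" for y
  proof (cases "y \<in> ball z (2 * r)")
    case False
    obtain m where "dist z y / r < 2 ^ m"
      using real_arch_pow[of 2 "dist z y / r"] by auto
    also have "(2::real) ^ m \<le> 2 ^ (m + 2)" by (intro power_increasing) auto
    finally have "y \<in> ball z (2 ^ (m + 2) * r)" using r by (simp add: field_simps)
    then have ex: "\<exists>k. y \<in> ball z (2 ^ (k + 2) * r)" ..
    define k where "k = (LEAST k. y \<in> ball z (2 ^ (k + 2) * r))"
    have k: "y \<in> ball z (2 ^ (k + 2) * r)" unfolding k_def using ex by (rule LeastI_ex)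
    have ge: "2 ^ (k + 1) * r \<le> dist z y"
    proof (cases k)
      case 0 then show ?thesis using False by simp
    next
      case (Suc j)
      then show ?thesis
        using not_less_Least[of j "\<lambda>k. y \<in> ball z (2 ^ (k + 2) * r)"] by (simp add: k_def)
    qed
    \<comment> \<open>\<open>x\<close> is closer than \<open>r\<close> to the centre, so its
      distance to \<open>y\<close> is at least \<open>2 ^ (k + 1) * r - r\<close>, and this is at
      least \<open>2 ^ k * r\<close>.\<close>
    have "r \<le> 2 ^ k * r" using r by simp
    then have "2 ^ k * r \<le> norm (x - y)"
      using ge x dist_triangle[of z y x] by (simp add: dist_norm)
    then have "2 ^ k \<le> norm (x - y) / r" using r by (simp add: field_simps)
    then have "(norm (x - y) / r) powr - c \<le> (2 ^ k) powr - c"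
      using assms by (intro powr_mono2') auto
    then have "ennreal ((norm (x - y) / r) powr - c) * h y * indicator (- ball z (2 * r)) y
      \<le> ennreal ((2 ^ k) powr - c) * (h y * indicator (ball z (2 ^ (k + 2) * r)) y)"
      using k False by (simp add: mult_right_mono ennreal_leI)
    also have "\<dots> \<le> (\<Sum>k. ennreal ((2 ^ k) powr - c) * (h y * indicator (ball z (2 ^ (k + 2) * r)) y))"
      by (rule ennreal_le_suminf)
    finally show ?thesis .
  qed simp
  \<comment> \<open>The ball of radius \<open>2 ^ (k + 2) * r\<close> belongs to the index
    \<open>l = Suc k\<close>. The factor \<open>2 powr \<epsilon>\<close> in \<open>Q\<close> pays
    for this shift.\<close>
  have tm: "ennreal ((2 ^ k) powr - c) * (\<integral>\<^sup>+ y\<in>ball z (2 ^ (k + 2) * r). h y \<partial>lborel)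
    \<le> ennreal Q * (ennreal (2 powr (- real (Suc k) * \<epsilon>)) * X (Suc k))" for k
  proof -
    have "(\<integral>\<^sup>+ y\<in>ball z (2 ^ (k + 2) * r). h y \<partial>lborel)
      \<le> ennpowr (emeasure lborel (ball z (2 ^ (k + 2) * r))) (1 - 1 / p) * X (Suc k)"
      unfolding X_def using \<open>1 < p\<close> nn_integral_le_enn_Lp[of p "ball z (2 ^ (k + 2) * r)" h] by simp
    also have "emeasure lborel (ball z (2 ^ (k + 2) * r)) = ennreal ((2 ^ (k + 2)) ^ DIM('a) * w)"
      using r by (simp add: emeasure_ball w_def n_def power_mult_distrib mult_ac)
    also have "ennpowr \<dots> (1 - 1 / p) = ennreal (((2 ^ (k + 2)) ^ DIM('a)) powr (1 - 1 / p) * w powr (1 - 1 / p))"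
      using w by (simp add: ennpowr_ennreal powr_mult)
    \<comment> \<open>The exponent \<open>1 - 1 / p\<close> of the dyadic factor is raised to 1; the
      decay \<open>c \<ge> n + \<epsilon>\<close> absorbs the whole volume growth and still leaves
      \<open>\<epsilon>\<close>.\<close>
    also have "\<dots> \<le> ennreal ((2 ^ (k + 2)) ^ DIM('a) * w powr (1 - 1 / p))"
    proof -
      have 1: "1 \<le> ((2::real) ^ (k + 2)) ^ DIM('a)" by (intro one_le_power) simp
      have "((2 ^ (k + 2)) ^ DIM('a)) powr (1 - 1 / p) \<le> ((2 ^ (k + 2)) ^ DIM('a)) powr (1::real)"
        using \<open>1 < p\<close> by (intro powr_mono[OF _ 1]) simp
      then show ?thesis by (intro ennreal_leI mult_right_mono) auto
    qed
    finally have 1: "ennreal ((2 ^ k) powr - c) * (\<integral>\<^sup>+ y\<in>ball z (2 ^ (k + 2) * r). h y \<partial>lborel)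
      \<le> ennreal ((2 ^ k) powr - c) * (ennreal ((2 ^ (k + 2)) ^ DIM('a) * w powr (1 - 1 / p)) * X (Suc k))"
      by (simp add: mult_left_mono mult_right_mono)
    have "(2 ^ k) powr - c * (2 ^ (k + 2)) ^ DIM('a) \<le> 4 ^ DIM('a) * 2 powr \<epsilon> * 2 powr (- real (Suc k) * \<epsilon>)"
    proof -
      have "(2 ^ (k + 2)) ^ DIM('a) = 4 ^ DIM('a) * (2 ^ k) powr n"
        by (simp add: n_def powr_realpow power_mult_distrib)
      then have "(2 ^ k) powr - c * (2 ^ (k + 2)) ^ DIM('a) = 4 ^ DIM('a) * (2 ^ k) powr (n - c)"
        by (simp add: powr_diff powr_minus field_simps)
      also have "\<dots> \<le> 4 ^ DIM('a) * (2 ^ k) powr (- \<epsilon>)"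
        using assms by (intro mult_left_mono powr_mono) (auto simp: n_def)
      also have "(2 ^ k) powr (- \<epsilon>) = 2 powr \<epsilon> * 2 powr (- real (Suc k) * \<epsilon>)"
      proof -
        have "((2::real) ^ k) powr (- \<epsilon>) = (2 powr real k) powr (- \<epsilon>)"
          by (simp add: powr_realpow)
        also have "\<dots> = 2 powr (real k * - \<epsilon>)" by (rule powr_powr)
        also have "real k * - \<epsilon> = \<epsilon> + - real (Suc k) * \<epsilon>" by (simp add: algebra_simps)
        finally show ?thesis by (simp only: powr_add)
      qed
      finally show ?thesis by (simp only: mult.assoc)
    qed
    from mult_right_mono[OF this, of "w powr (1 - 1 / p)"]
    have 2: "(2 ^ k) powr - c * ((2 ^ (k + 2)) ^ DIM('a) * w powr (1 - 1 / p)) \<le> Q * 2 powr (- real (Suc k) * \<epsilon>)"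
      by (simp only: Q_def mult_ac powr_ge_zero simp_thms)
    have "ennreal ((2 ^ k) powr - c) * (ennreal ((2 ^ (k + 2)) ^ DIM('a) * w powr (1 - 1 / p)) * X (Suc k))
      \<le> ennreal Q * (ennreal (2 powr (- real (Suc k) * \<epsilon>)) * X (Suc k))"
      by (rule ennreal_mult_mult_right_mono[OF 2]) (simp_all add: Q_def)
    with 1 show ?thesis by (rule order_trans)
  qed
  have meas: "(\<lambda>y. h y * indicator (ball z (2 ^ (k + 2) * r)) y) \<in> borel_measurable lborel" for k
    by (intro borel_measurable_times_ennreal borel_measurable_indicator) auto
  have "(\<integral>\<^sup>+ y\<in>- ball z (2 * r). ennreal ((norm (x - y) / r) powr - c) * h y \<partial>lborel)
    \<le> (\<integral>\<^sup>+ y. (\<Sum>k. ennreal ((2 ^ k) powr - c) * (h y * indicator (ball z (2 ^ (k + 2) * r)) y)) \<partial>lborel)"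
    by (intro nn_integral_mono pt)
  also have "\<dots> = (\<Sum>k. \<integral>\<^sup>+ y. ennreal ((2 ^ k) powr - c) * (h y * indicator (ball z (2 ^ (k + 2) * r)) y) \<partial>lborel)"
    by (intro nn_integral_suminf borel_measurable_times_ennreal borel_measurable_const meas)
  also have "\<dots> = (\<Sum>k. ennreal ((2 ^ k) powr - c) * (\<integral>\<^sup>+ y\<in>ball z (2 ^ (k + 2) * r). h y \<partial>lborel))"
    by (intro suminf_cong nn_integral_cmult meas)
  also have "\<dots> \<le> (\<Sum>k. ennreal Q * (ennreal (2 powr (- real (Suc k) * \<epsilon>)) * X (Suc k)))"
    by (intro suminf_le tm) auto
  also have "\<dots> = ennreal Q * (\<Sum>k. ennreal (2 powr (- real (Suc k) * \<epsilon>)) * X (Suc k))"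
    by (rule ennreal_suminf_cmult)
  also have "\<dots> \<le> ennreal Q * (\<Sum>l. ennreal (2 powr (- real l * \<epsilon>)) * X l)"
    using suminf_offset[OF summableI, of "\<lambda>l. ennreal (2 powr (- real l * \<epsilon>)) * X l" 1]
    by (intro mult_left_mono) (auto simp: add_increasing2)
  finally show ?thesis by (simp add: Q_def X_def w_def n_def)
qed

text \<open>The near part is the truncated Riesz potential and contributes only to the entry
  \<open>l = 0\<close>. The far part is bounded by a constant on the ball. Both scale as
  \<open>r powr (n - s)\<close>.\<close>

lemma potential_Lp:
  fixes p q s b c \<epsilon> :: real
  assumes "1 < p" "0 < q" "0 < s" "1 / q = 1 / p - s / DIM('a::euclidean_space)"
    and "0 \<le> b" "b < DIM('a) - s" "0 < \<epsilon>" "DIM('a) + \<epsilon> \<le> c"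
  shows "\<exists>C>0. \<forall>(z::'a) r (h::'a \<Rightarrow> ennreal). r > 0 \<longrightarrow> h \<in> borel_measurable borel \<longrightarrow>
    enn_Lp q (ball z r) (potential b c z r h) \<le> ennreal (C * r powr (DIM('a) - s)) *
      (\<Sum>l. ennreal (2 powr (- real l * \<epsilon>)) * enn_Lp p (ball z (2 ^ (l + 1) * r)) h)"
proof -
  define n where "n = real DIM('a)"
  have n: "n > 0" by (simp add: n_def)
  define w where "w = unit_ball_vol n"
  have w: "w > 0" by (simp add: w_def n_def)
  obtain C1 where C1: "C1 > 0" "\<And>(z::'a) r h. r > 0 \<Longrightarrow> h \<in> borel_measurable borel \<Longrightarrow>
    enn_Lp q (ball z r) (\<lambda>x. \<integral>\<^sup>+ y\<in>ball z (2 * r). ennreal (norm (x - y) powr - b) * h y \<partial>lborel)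
    \<le> ennreal (C1 * r powr (n - s - b)) * enn_Lp p (ball z (2 * r)) h"
    using Riesz_potential_Lp[OF assms(1-6)] unfolding n_def by blast
  define C2 where "C2 = 4 ^ DIM('a) * 2 powr \<epsilon> * w powr (1 - 1 / p + 1 / q)"
  have C2: "C2 > 0" using w by (simp add: C2_def)
  define C where "C = 2 powr (1 + 1 / q) * (C1 + C2)"
  have "enn_Lp q (ball z r) (potential b c z r h) \<le> ennreal (C * r powr (n - s)) *
      (\<Sum>l. ennreal (2 powr (- real l * \<epsilon>)) * enn_Lp p (ball z (2 ^ (l + 1) * r)) h)"
    if r: "r > 0" and h[measurable]: "h \<in> borel_measurable borel" for z :: 'a and r and h :: "'a \<Rightarrow> ennreal"
  proof -
    define S where "S = (\<Sum>l. ennreal (2 powr (- real l * \<epsilon>)) * enn_Lp p (ball z (2 ^ (l + 1) * r)) h)"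
    define near where "near x = (\<integral>\<^sup>+ y\<in>ball z (2 * r). ennreal (norm (x - y) powr - b) * h y \<partial>lborel)" for x
    have [measurable]: "near \<in> borel_measurable borel"
    proof -
      have [measurable]: "h \<in> borel_measurable lborel" by simp
      show ?thesis unfolding near_def[abs_def] indicator_def mem_ball by measurable
    qed
    \<comment> \<open>\<open>T\<close> does not depend on \<open>x\<close>, so its norm over the
      ball is \<open>T\<close> times the measure of the ball to the power
      \<open>1 / q\<close>.\<close>
    define T where "T = ennreal (4 ^ DIM('a) * 2 powr \<epsilon> * (w * r ^ DIM('a)) powr (1 - 1 / p)) * S"
    have meas: "(\<lambda>y. ennreal (norm (x - y) powr - b) * h y * indicator (ball z (2 * r)) y) \<in> borel_measurable lborel"
      "(\<lambda>y. ennreal ((norm (x - y) / r) powr - c) * h y * indicator (- ball z (2 * r)) y) \<in> borel_measurable lborel" for x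
      by (intro borel_measurable_times_ennreal borel_measurable_indicator; simp)+
    have split: "potential b c z r h x \<le> ennreal (r powr b) * near x + T" if x: "x \<in> ball z r" for x
    proof -
      have "potential b c z r h x = (\<integral>\<^sup>+ y. ennreal (r powr b) * (ennreal (norm (x - y) powr - b) * h y * indicator (ball z (2 * r)) y)
          + ennreal ((norm (x - y) / r) powr - c) * h y * indicator (- ball z (2 * r)) y \<partial>lborel)"
        unfolding potential_def
      proof (intro nn_integral_cong)
        fix y
        have "(norm (x - y) / r) powr - b = r powr b * norm (x - y) powr - b"
          using r by (simp add: powr_divide powr_minus divide_simps)
        then show "ennreal ((norm (x - y) / r) powr - (if y \<in> ball z (2 * r) then b else c)) * h y
          = ennreal (r powr b) * (ennreal (norm (x - y) powr - b) * h y * indicator (ball z (2 * r)) y)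
          + ennreal ((norm (x - y) / r) powr - c) * h y * indicator (- ball z (2 * r)) y"
          by (auto simp: indicator_def ennreal_mult mult.assoc)
      qed
      also have "\<dots> = ennreal (r powr b) * near x
          + (\<integral>\<^sup>+ y\<in>- ball z (2 * r). ennreal ((norm (x - y) / r) powr - c) * h y \<partial>lborel)"
        unfolding near_def
        by (simp only: nn_integral_add nn_integral_cmult meas borel_measurable_times_ennreal borel_measurable_const)
      also have "(\<integral>\<^sup>+ y\<in>- ball z (2 * r). ennreal ((norm (x - y) / r) powr - c) * h y \<partial>lborel) \<le> T"
        unfolding T_def S_def w_def n_def using assms r x by (intro potential_tail_le) auto
      finally show ?thesis by (simp add: add_mono)
    qed
    have "enn_Lp q (ball z r) (potential b c z r h) \<le> enn_Lp q (ball z r) (\<lambda>x. ennreal (r powr b) * near x + T)"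
      using assms split by (intro enn_Lp_mono) auto
    also have "\<dots> \<le> ennreal (2 powr (1 + 1 / q)) *
        (enn_Lp q (ball z r) (\<lambda>x. ennreal (r powr b) * near x) + enn_Lp q (ball z r) (\<lambda>x. T))"
      using assms by (intro enn_Lp_add_le) auto
    also have "enn_Lp q (ball z r) (\<lambda>x. ennreal (r powr b) * near x) \<le> ennreal (C1 * r powr (n - s)) * S"
    proof -
      have "enn_Lp q (ball z r) (\<lambda>x. ennreal (r powr b) * near x) = ennreal (r powr b) * enn_Lp q (ball z r) near"
        using assms by (intro enn_Lp_cmult) auto
      also have "\<dots> \<le> ennreal (r powr b) * (ennreal (C1 * r powr (n - s - b)) * enn_Lp p (ball z (2 * r)) h)"
        unfolding near_def using C1(2)[OF r h] by (intro mult_left_mono) auto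
      also have "\<dots> = ennreal (C1 * r powr (n - s)) * enn_Lp p (ball z (2 * r)) h"
        using C1(1) by (simp add: mult.assoc[symmetric] ennreal_mult[symmetric] powr_diff)
      also have "enn_Lp p (ball z (2 * r)) h \<le> S"
        unfolding S_def using ennreal_le_suminf[of "\<lambda>l. ennreal (2 powr (- real l * \<epsilon>)) * enn_Lp p (ball z (2 ^ (l + 1) * r)) h" 0]
        by simp
      finally show ?thesis by (simp add: mult_left_mono)
    qed
    also have "enn_Lp q (ball z r) (\<lambda>x. T) = ennreal (C2 * r powr (n - s)) * S"
    proof -
      have 1: "r ^ DIM('a) = r powr n" using r by (simp add: n_def powr_realpow)
      \<comment> \<open>The measure of the ball enters with exponent \<open>1 - 1 / p\<close> from
        Hoelder in the tail and \<open>1 / q\<close> from the outer norm; together they give the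
        power \<open>n - s\<close> of the radius.\<close>
      have "n * (1 / q) = n * (1 / p) - s"
        unfolding assms(4) using n by (simp add: n_def right_diff_distrib)
      then have "n * (1 - 1 / p + 1 / q) = n - s" by (simp add: algebra_simps)
      then have 2: "(r powr n) powr (1 - 1 / p + 1 / q) = r powr (n - s)"
        unfolding powr_powr by simp
      have "enn_Lp q (ball z r) (\<lambda>x. T) = T * ennreal ((w * r powr n) powr (1 / q))"
        using assms r w
        by (simp add: enn_Lp_const emeasure_ball n_def[symmetric] w_def[symmetric] 1 ennpowr_ennreal)
      also have "\<dots> = ennreal (4 ^ DIM('a) * 2 powr \<epsilon> * ((w * r powr n) powr (1 - 1 / p) * (w * r powr n) powr (1 / q))) * S"
        unfolding T_def 1 by (simp add: ennreal_mult mult_ac)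
      also have "(w * r powr n) powr (1 - 1 / p) * (w * r powr n) powr (1 / q) = w powr (1 - 1 / p + 1 / q) * r powr (n - s)"
        using w unfolding powr_add[symmetric] 2[symmetric] by (simp add: powr_mult)
      finally show ?thesis by (simp add: C2_def mult_ac)
    qed
    also have "ennreal (2 powr (1 + 1 / q)) * (ennreal (C1 * r powr (n - s)) * S + ennreal (C2 * r powr (n - s)) * S)
        = ennreal (C * r powr (n - s)) * S"
    proof -
      have "C * r powr (n - s) = 2 powr (1 + 1 / q) * (C1 * r powr (n - s) + C2 * r powr (n - s))"
        by (simp only: C_def distrib_left distrib_right mult.assoc)
      then show ?thesis
        using C1(1) C2 by (simp add: ennreal_mult distrib_right mult.assoc)
    qed
    finally show ?thesis by (simp add: S_def mult_left_mono add_right_mono)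
  qed
  moreover have "C > 0" using C1 C2 by (simp add: C_def add_pos_pos)
  ultimately show ?thesis unfolding n_def by blast
qed

section \<open>Kernel decay and the gradient\<close>

text \<open>Trades the unspecified profile for an explicit power: the limit controls large arguments
  and boundedness the rest. Writing time as \<open>\<rho> powr m\<close> turns \<open>\<rho>\<close>
  into the length scale of the kernel.\<close>

lemma kernel_bound_decay:
  fixes k :: "real \<Rightarrow> 'a::euclidean_space \<Rightarrow> 'a \<Rightarrow> 'k::real_normed_vector" and m \<epsilon> :: real
  assumes "kernel_bound m \<epsilon> k" "m > 0" "\<epsilon> > 0"
  shows "\<exists>C>0. \<forall>\<rho>>0. \<forall>x y. norm (k (\<rho> powr m) x y)
    \<le> C * \<rho> powr - real DIM('a) * (1 + norm (x - y) / \<rho>) powr - (2 * real DIM('a) + \<epsilon>)"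
proof -
  define N where "N = 2 * real DIM('a) + \<epsilon>"
  have N: "N > 0" using assms by (simp add: N_def add_pos_pos)
  obtain \<gamma> :: "real \<Rightarrow> real" where g: "\<forall>r\<ge>0. \<gamma> r \<ge> 0" "bounded (\<gamma> ` {0..})"
    "((\<lambda>r. r powr N * \<gamma> r) \<longlongrightarrow> 0) at_top"
    and kb: "\<And>t x y. t > 0 \<Longrightarrow>
        norm (k t x y) \<le> t powr (- real DIM('a) / m) * \<gamma> (norm (x - y) / t powr (1 / m))"
    using assms(1) unfolding kernel_bound_def N_def by blast
  obtain B where B: "\<And>v. v \<ge> 0 \<Longrightarrow> \<gamma> v \<le> B" "B > 0"
    using g(2) unfolding bounded_pos by (auto simp: abs_le_iff)
  have "eventually (\<lambda>r. r powr N * \<gamma> r < 1) at_top"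
    using g(3) by (intro order_tendstoD) auto
  then obtain R0 where R0: "\<And>r. r \<ge> R0 \<Longrightarrow> r powr N * \<gamma> r < 1"
    by (auto simp: eventually_at_top_linorder)
  \<comment> \<open>\<open>R \<ge> 1\<close> allows \<open>1 + v \<le> 2 * v\<close> beyond
    \<open>R\<close>, the source of \<open>2 powr N\<close> in \<open>C\<close>; the other summand
    of \<open>C\<close> covers arguments below \<open>R\<close>.\<close>
  define R where "R = max 1 R0"
  define C where "C = 2 powr N + B * (1 + R) powr N"
  have C: "C > 0" using B by (simp add: C_def add_pos_nonneg)
  have dec: "\<gamma> v \<le> C * (1 + v) powr - N" if v: "v \<ge> 0" for v
  proof (cases "v \<ge> R")
    case True
    then have v1: "v \<ge> 1" "v powr N * \<gamma> v < 1" using R0 by (auto simp: R_def)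
    have "(1 + v) powr N * \<gamma> v \<le> (2 * v) powr N * \<gamma> v"
      using v1 v g(1) N by (intro mult_right_mono powr_mono2) auto
    also have "\<dots> = 2 powr N * (v powr N * \<gamma> v)" using v by (simp add: powr_mult)
    also have "\<dots> \<le> 2 powr N * 1" using v1 by (intro mult_left_mono) auto
    also have "\<dots> \<le> C" using B by (simp add: C_def)
    finally show ?thesis using v by (simp add: powr_minus field_simps)
  next
    case False
    have "(1 + v) powr N * \<gamma> v \<le> (1 + R) powr N * B"
      using v False B g(1) N by (intro mult_mono powr_mono2) auto
    also have "\<dots> \<le> C" by (simp add: C_def)
    finally show ?thesis using v by (simp add: powr_minus field_simps)
  qed
  have "norm (k (\<rho> powr m) x y) \<le> C * \<rho> powr - real DIM('a) * (1 + norm (x - y) / \<rho>) powr - N"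
    if \<rho>: "\<rho> > 0" for \<rho> x y
  proof -
    have "norm (k (\<rho> powr m) x y) \<le> \<rho> powr - real DIM('a) * \<gamma> (norm (x - y) / \<rho>)"
      using kb[of "\<rho> powr m" x y] \<rho> assms by (simp add: powr_powr)
    also have "\<dots> \<le> \<rho> powr - real DIM('a) * (C * (1 + norm (x - y) / \<rho>) powr - N)"
      using \<rho> by (intro mult_left_mono dec) auto
    finally show ?thesis by (simp only: mult_ac)
  qed
  then show ?thesis using C unfolding N_def by (intro exI[of _ C] conjI allI impI)
qed

text \<open>Part of the decay is traded for a power of the scale:
  \<open>(1 + v) powr - N \<le> v powr - a\<close> for every \<open>a\<close> in
  \<open>{0..N}\<close>, and rescaling then leaves \<open>2 powr (j * (n - a))\<close>. With
  \<open>\<kappa> \<ge> 0\<close> this bounds the growth of averages at fine scales, with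
  \<open>\<kappa> = - \<delta>\<close> the decay of errors. The power of \<open>d / r\<close> that
  remains is free of \<open>j\<close>.\<close>

lemma scaled_decay_le:
  fixes r d a N n \<kappa> j :: real
  assumes "r > 0" "d > 0" "0 \<le> j" "0 \<le> a" "a \<le> N" "n - \<kappa> \<le> a"
  shows "(r * 2 powr - j) powr - n * (1 + d / (r * 2 powr - j)) powr - N
    \<le> r powr - n * 2 powr (j * \<kappa>) * (d / r) powr - a"
proof -
  define v where "v = d / (r * 2 powr - j)"
  have v: "v > 0" "v = d / r * 2 powr j"
    using assms by (auto simp: v_def powr_minus field_simps)
  have "(1 + v) powr - N \<le> (1 + v) powr - a"
    using v assms by (intro powr_mono) auto
  also have "\<dots> \<le> v powr - a"
    using v assms by (intro powr_mono2') auto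
  also have "\<dots> = (d / r) powr - a * 2 powr (j * - a)"
    using assms unfolding v(2) by (subst powr_mult) (auto simp: powr_powr)
  finally have "(r * 2 powr - j) powr - n * (1 + v) powr - N
    \<le> (r * 2 powr - j) powr - n * ((d / r) powr - a * 2 powr (j * - a))"
    by (intro mult_left_mono) auto
  moreover have "(r * 2 powr - j) powr - n = r powr - n * 2 powr (j * n)"
    using assms by (subst powr_mult) (auto simp: powr_powr)
  ultimately have "(r * 2 powr - j) powr - n * (1 + v) powr - N
    \<le> r powr - n * 2 powr (j * n) * ((d / r) powr - a * 2 powr (j * - a))"
    by (simp only:)
  also have "r powr - n * 2 powr (j * n) * ((d / r) powr - a * 2 powr (j * - a))
    = r powr - n * 2 powr (j * n + j * - a) * (d / r) powr - a"
    by (simp only: powr_add mult_ac)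
  also have "\<dots> \<le> r powr - n * 2 powr (j * \<kappa>) * (d / r) powr - a"
  proof -
    have "j * n + j * - a = j * (n - a)" by (simp add: algebra_simps)
    also have "\<dots> \<le> j * \<kappa>" using assms by (intro mult_left_mono) auto
    finally show ?thesis by (intro mult_left_mono mult_right_mono powr_mono) auto
  qed
  finally show ?thesis by (simp only: v_def)
qed

text \<open>Holds for every function: the Bochner integral of a non-integrable function is 0, and
  nonnegative integrals over a measure and its completion agree without a measurability
  condition.\<close>

lemma norm_lebesgue_integral_le_nn_integral:
  fixes f :: "'a::euclidean_space \<Rightarrow> 'b::{banach, second_countable_topology}"
  shows "ennreal (norm (integral\<^sup>L lebesgue f)) \<le> (\<integral>\<^sup>+ y. ennreal (norm (f y)) \<partial>lborel)"
proof (cases "integrable lebesgue f")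
  case True
  then show ?thesis
    using integral_norm_bound_ennreal[OF True] by (simp add: nn_integral_completion)
qed (simp add: not_integrable_integral_eq)

lemma continuous_on_imp_lebesgue_measurable:
  fixes f :: "'a::euclidean_space \<Rightarrow> 'b::euclidean_space"
  shows "continuous_on UNIV f \<Longrightarrow> f \<in> borel_measurable lebesgue"
  by (intro measurable_completion) (simp add: borel_measurable_continuous_onI)

lemma C1_fun_continuous_on: "C1_fun f \<Longrightarrow> continuous_on A f"
  unfolding C1_fun_def by (blast intro: continuous_at_imp_continuous_on has_derivative_continuous)

lemma C1_fun_grad:
  fixes f :: "'a::euclidean_space \<Rightarrow> 'k::real_normed_vector"
  assumes "C1_fun f"
  shows "\<exists>f' :: 'a \<Rightarrow> 'a \<Rightarrow>\<^sub>L 'k. (\<forall>x. (f has_derivative blinfun_apply (f' x)) (at x)) \<and>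
    continuous_on UNIV f' \<and> (\<forall>x. grad_norm f x = sqrt (\<Sum>b\<in>Basis. (norm (f' x b))\<^sup>2))"
proof -
  obtain f' :: "'a \<Rightarrow> 'a \<Rightarrow>\<^sub>L 'k" where f': "\<And>x. (f has_derivative blinfun_apply (f' x)) (at x)"
    "continuous_on UNIV f'"
    using assms unfolding C1_fun_def by blast
  have "grad_norm f x = sqrt (\<Sum>b\<in>Basis. (norm (f' x b))\<^sup>2)" for x
    unfolding grad_norm_def frechet_derivative_at[OF f'(1), symmetric] ..
  with f' show ?thesis by blast
qed

lemma continuous_on_grad_norm:
  assumes "C1_fun f"
  shows "continuous_on A (grad_norm f)"
proof -
  obtain f' where "\<And>x. (f has_derivative blinfun_apply (f' x)) (at x)" and f': "continuous_on UNIV f'"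
    "\<And>x. grad_norm f x = sqrt (\<Sum>b\<in>Basis. (norm (blinfun_apply (f' x) b))\<^sup>2)"
    using C1_fun_grad[OF assms] by blast
  have "continuous_on A (\<lambda>x. sqrt (\<Sum>b\<in>Basis. (norm (blinfun_apply (f' x) b))\<^sup>2))"
    using continuous_on_subset[OF f'(1), of A] by (auto intro!: continuous_intros)
  then show ?thesis by (simp add: f'(2)[symmetric])
qed

lemma grad_norm_nonneg [simp]: "0 \<le> grad_norm f x"
  by (simp add: grad_norm_def sum_nonneg)

text \<open>Fundamental theorem of calculus on the segment from \<open>x\<close> to
  \<open>y\<close>. An average of the gradient over the segment, instead of a supremum, is what can
  later be turned into a potential.\<close>

lemma C1_fun_norm_diff_le:
  fixes f :: "'a::euclidean_space \<Rightarrow> 'k::euclidean_space"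
  assumes "C1_fun f"
  shows "ennreal (norm (f y - f x))
    \<le> ennreal (norm (y - x)) * (\<integral>\<^sup>+ \<tau>\<in>{0..1}. ennreal (grad_norm f (x + \<tau> *\<^sub>R (y - x))) \<partial>lborel)"
proof -
  obtain f' where f': "\<And>x. (f has_derivative blinfun_apply (f' x)) (at x)" "continuous_on UNIV f'"
    "\<And>x. grad_norm f x = sqrt (\<Sum>b\<in>Basis. (norm (blinfun_apply (f' x) b))\<^sup>2)"
    using C1_fun_grad[OF assms] by blast
  \<comment> \<open>Cauchy-Schwarz in coordinates: the operator norm of the derivative is at most
    the Euclidean length of the vector of partial derivatives.\<close>
  have op: "norm (f' u v) \<le> norm v * grad_norm f u" for u v
  proof -
    have "norm (f' u v) = norm (\<Sum>b\<in>Basis. (v \<bullet> b) *\<^sub>R f' u b)"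
      by (subst euclidean_representation[of v, symmetric]) (simp add: blinfun.sum_right blinfun.scaleR_right)
    also have "\<dots> \<le> (\<Sum>b\<in>Basis. \<bar>v \<bullet> b\<bar> * \<bar>norm (f' u b)\<bar>)"
      by (rule order_trans[OF norm_sum]) simp
    also have "\<dots> \<le> L2_set (\<lambda>b. v \<bullet> b) Basis * L2_set (\<lambda>b. norm (f' u b)) Basis"
      by (rule L2_set_mult_ineq)
    also have "\<dots> = norm v * grad_norm f u"
      by (simp add: f'(3) L2_set_def norm_eq_sqrt_inner[of v] euclidean_inner[of v v] power2_eq_square)
    finally show ?thesis .
  qed
  define v where "v = y - x"
  define F where "F \<tau> = f (x + \<tau> *\<^sub>R v)" for \<tau> :: real
  have der: "(F has_vector_derivative f' (x + \<tau> *\<^sub>R v) v) (at \<tau> within A)" for \<tau> A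
    unfolding F_def has_vector_derivative_def
    by (rule has_derivative_eq_rhs[OF has_derivative_compose[OF _ f'(1)]])
       (auto intro!: derivative_eq_intros simp: blinfun.scaleR_right)
  have cont: "continuous_on {0..1} (\<lambda>\<tau>. f' (x + \<tau> *\<^sub>R v) v)"
    by (intro continuous_intros continuous_on_compose2[OF f'(2)]) auto
  have "(LBINT \<tau>. indicator {0..1} \<tau> *\<^sub>R f' (x + \<tau> *\<^sub>R v) v) = F 1 - F 0"
    using der cont by (intro integral_FTC_Icc) auto
  also have "F 1 - F 0 = f y - f x" by (simp add: F_def v_def)
  finally have "ennreal (norm (f y - f x)) = ennreal (norm (LBINT \<tau>. indicator {0..1} \<tau> *\<^sub>R f' (x + \<tau> *\<^sub>R v) v))"
    by simp
  also have "\<dots> \<le> (\<integral>\<^sup>+ \<tau>. ennreal (norm (indicator {0..1} \<tau> *\<^sub>R f' (x + \<tau> *\<^sub>R v) v)) \<partial>lborel)"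
    using borel_integrable_atLeastAtMost'[OF cont]
    by (intro integral_norm_bound_ennreal) (simp add: set_integrable_def)
  also have "\<dots> \<le> (\<integral>\<^sup>+ \<tau>. ennreal (norm v) * (ennreal (grad_norm f (x + \<tau> *\<^sub>R v)) * indicator {0..1} \<tau>) \<partial>lborel)"
    by (intro nn_integral_mono)
       (auto simp: indicator_def ennreal_mult[symmetric] intro!: ennreal_leI op)
  also have "\<dots> = ennreal (norm v) * (\<integral>\<^sup>+ \<tau>\<in>{0..1}. ennreal (grad_norm f (x + \<tau> *\<^sub>R v)) \<partial>lborel)"
  proof (rule nn_integral_cmult)
    have [measurable]: "grad_norm f \<in> borel_measurable borel"
      by (intro borel_measurable_continuous_onI continuous_on_grad_norm assms)
    show "(\<lambda>\<tau>. ennreal (grad_norm f (x + \<tau> *\<^sub>R v)) * indicator {0..1} \<tau>) \<in> borel_measurable lborel"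
      by measurable
  qed
  finally show ?thesis by (simp add: v_def)
qed

section \<open>Averages and errors as potentials\<close>

text \<open>The exponent used is \<open>n - \<kappa>\<close> near the ball and \<open>N\<close> away
  from it. Both lie between \<open>n - \<kappa>\<close> and \<open>N\<close>, so
  \<open>scaled_decay_le\<close> gives the same growth \<open>2 powr (j * \<kappa>)\<close> in both
  regions.\<close>

lemma kernel_op_le_potential:
  fixes k :: "'a::euclidean_space \<Rightarrow> 'a \<Rightarrow> 'k::{real_normed_field,euclidean_space}" and r j \<kappa> C N :: real
  assumes "r > 0" "0 \<le> j" "0 \<le> C" "0 \<le> \<kappa>" "\<kappa> \<le> DIM('a)" "DIM('a) \<le> N"
    and [measurable]: "g \<in> borel_measurable borel"
    and bound: "\<And>y. norm (k x y) \<le> C * (r * 2 powr - j) powr - real DIM('a) *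
      (1 + norm (x - y) / (r * 2 powr - j)) powr - N"
  shows "ennreal (norm (kernel_op k g x)) \<le> ennreal (C * r powr - real DIM('a) * 2 powr (j * \<kappa>)) *
    potential (DIM('a) - \<kappa>) N z r (\<lambda>y. ennreal (norm (g y))) x"
proof -
  define c where "c = C * r powr - real DIM('a) * 2 powr (j * \<kappa>)"
  define a where "a y = (if y \<in> ball z (2 * r) then DIM('a) - \<kappa> else N)" for y
  have c: "c \<ge> 0" using assms by (simp add: c_def)
  \<comment> \<open>The point \<open>y = x\<close> is left out because a power of 0 is 0, so the
    right side vanishes there; a single point is a null set.\<close>
  have pt: "ennreal (norm (k x y * g y)) \<le> ennreal c * (ennreal ((norm (x - y) / r) powr - a y) * ennreal (norm (g y)))"
    if "y \<noteq> x" for y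
  proof -
    have "(r * 2 powr - j) powr - real DIM('a) * (1 + norm (x - y) / (r * 2 powr - j)) powr - N
      \<le> r powr - real DIM('a) * 2 powr (j * \<kappa>) * (norm (x - y) / r) powr - a y"
      using assms that by (intro scaled_decay_le) (auto simp: a_def)
    from mult_left_mono[OF this \<open>0 \<le> C\<close>] bound[of y]
    have "norm (k x y) \<le> c * (norm (x - y) / r) powr - a y"
      by (simp add: c_def mult.assoc)
    then have "norm (k x y) * norm (g y) \<le> c * (norm (x - y) / r) powr - a y * norm (g y)"
      by (intro mult_right_mono) auto
    then show ?thesis
      using c by (simp add: norm_mult ennreal_mult[symmetric] mult.assoc ennreal_leI)
  qed
  have "ennreal (norm (kernel_op k g x)) \<le> (\<integral>\<^sup>+ y. ennreal (norm (k x y * g y)) \<partial>lborel)"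
    unfolding kernel_op_def by (rule norm_lebesgue_integral_le_nn_integral)
  also have "\<dots> \<le> (\<integral>\<^sup>+ y. ennreal c * (ennreal ((norm (x - y) / r) powr - a y) * ennreal (norm (g y))) \<partial>lborel)"
    using AE_lborel_singleton[of x] by (intro nn_integral_mono_AE) (auto elim!: eventually_mono intro: pt)
  also have "\<dots> = ennreal c * potential (DIM('a) - \<kappa>) N z r (\<lambda>y. ennreal (norm (g y))) x"
    unfolding potential_def a_def mem_ball by (rule nn_integral_cmult) measurable
  finally show ?thesis by (simp add: c_def)
qed

text \<open>As the kernel has integral 1, the error is the kernel integrated against increments of
  \<open>f\<close>. The increments become integrals of the gradient along segments. After Fubini,
  the substitution \<open>u = \<tau> *\<^sub>R (y - x)\<close> for fixed \<open>\<tau>\<close> turns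
  the inner integral into a potential, and the remaining power of \<open>\<tau>\<close> is
  integrable at 0.\<close>

lemma kernel_op_diff_le_potential:
  fixes k :: "'a::euclidean_space \<Rightarrow> 'a \<Rightarrow> 'k::{real_normed_field,euclidean_space}" and r j \<delta> C N :: real
  assumes r: "r > 0" and j: "0 \<le> j" and C: "0 \<le> C" and \<delta>: "0 < \<delta>" and N: "DIM('a) + \<delta> \<le> N"
    and f: "C1_fun f"
    and one: "integral\<^sup>L lebesgue (k x) = 1" and int: "integrable lebesgue (\<lambda>y. k x y * f y)"
    and bound: "\<And>y. norm (k x y) \<le> C * (r * 2 powr - j) powr - real DIM('a) *
      (1 + norm (x - y) / (r * 2 powr - j)) powr - N"
  shows "ennreal (norm (kernel_op k f x - f x)) \<le> ennreal (C * r powr (1 - real DIM('a)) * 2 powr (- j * \<delta>)) *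
    (\<integral>\<^sup>+ \<tau>\<in>ball (0::real) 2. ennreal (norm \<tau> powr - (1 - \<delta>)) \<partial>lborel) *
    potential (DIM('a) + \<delta> - 1) (N - 1) z r (\<lambda>y. ennreal (grad_norm f y)) x"
proof -
  define n where "n = real DIM('a)"
  define \<rho> where "\<rho> = r * 2 powr - j"
  have \<rho>: "\<rho> > 0" using r by (simp add: \<rho>_def)
  define \<phi> where "\<phi> v = C * \<rho> powr - n * (1 + norm v / \<rho>) powr - N * norm v" for v :: 'a
  define G where "G y = ennreal (grad_norm f y)" for y
  define c where "c = C * r powr (1 - n) * 2 powr (- j * \<delta>)"
  define P where "P = potential (n + \<delta> - 1) (N - 1) z r G x"
  have c: "c \<ge> 0" using C by (simp add: c_def)
  have "grad_norm f \<in> borel_measurable borel"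
    by (intro borel_measurable_continuous_onI continuous_on_grad_norm f)
  then have [measurable]: "G \<in> borel_measurable borel" "G \<in> borel_measurable lborel"
    by (simp_all add: G_def[abs_def])
  have [measurable]: "\<phi> \<in> borel_measurable borel" "\<phi> \<in> borel_measurable lborel"
    by (simp_all add: \<phi>_def[abs_def])
  have k: "integrable lebesgue (k x)"
    using one not_integrable_integral_eq[of lebesgue "k x"] by fastforce
  have "kernel_op k f x - f x = (LINT y|lebesgue. k x y * f y) - (LINT y|lebesgue. k x y * f x)"
    using one by (simp add: kernel_op_def integral_mult_left_zero)
  also have "\<dots> = (LINT y|lebesgue. k x y * f y - k x y * f x)"
    using int k by (intro Bochner_Integration.integral_diff[symmetric]) auto
  finally have "ennreal (norm (kernel_op k f x - f x)) \<le> (\<integral>\<^sup>+ y. ennreal (norm (k x y * f y - k x y * f x)) \<partial>lborel)"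
    using norm_lebesgue_integral_le_nn_integral[of "\<lambda>y. k x y * f y - k x y * f x"] by simp
  also have "\<dots> \<le> (\<integral>\<^sup>+ y. (\<integral>\<^sup>+ \<tau>. ennreal (\<phi> (y - x)) * (G (x + \<tau> *\<^sub>R (y - x)) * indicator {0..1} \<tau>) \<partial>lborel) \<partial>lborel)"
  proof (intro nn_integral_mono)
    fix y
    have "ennreal (norm (k x y * f y - k x y * f x)) = ennreal (norm (k x y)) * ennreal (norm (f y - f x))"
      by (simp add: right_diff_distrib[symmetric] norm_mult ennreal_mult)
    also have "\<dots> \<le> ennreal (C * \<rho> powr - n * (1 + norm (y - x) / \<rho>) powr - N) *
        (ennreal (norm (y - x)) * (\<integral>\<^sup>+ \<tau>\<in>{0..1}. G (x + \<tau> *\<^sub>R (y - x)) \<partial>lborel))"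
      using bound[of y] C1_fun_norm_diff_le[OF f, of y x] unfolding G_def \<rho>_def n_def
      by (intro mult_mono ennreal_leI) (auto simp: norm_minus_commute)
    also have "\<dots> = ennreal (\<phi> (y - x)) * (\<integral>\<^sup>+ \<tau>\<in>{0..1}. G (x + \<tau> *\<^sub>R (y - x)) \<partial>lborel)"
      using C by (simp add: \<phi>_def ennreal_mult mult.assoc)
    also have "\<dots> = (\<integral>\<^sup>+ \<tau>. ennreal (\<phi> (y - x)) * (G (x + \<tau> *\<^sub>R (y - x)) * indicator {0..1} \<tau>) \<partial>lborel)"
      by (rule nn_integral_cmult[symmetric]) measurable
    finally show "ennreal (norm (k x y * f y - k x y * f x))
      \<le> (\<integral>\<^sup>+ \<tau>. ennreal (\<phi> (y - x)) * (G (x + \<tau> *\<^sub>R (y - x)) * indicator {0..1} \<tau>) \<partial>lborel)" .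
  qed
  also have "\<dots> = (\<integral>\<^sup>+ \<tau>. (\<integral>\<^sup>+ y. ennreal (\<phi> (y - x)) * (G (x + \<tau> *\<^sub>R (y - x)) * indicator {0..1} \<tau>) \<partial>lborel) \<partial>lborel)"
    by (rule lborel_pair.Fubini') (unfold indicator_def atLeastAtMost_iff, measurable)
  \<comment> \<open>The indicator of \<open>{0..1}\<close> is relaxed to a ball of radius 2, the
    form in which power singularities are integrated by
    \<open>nn_integral_norm_powr_ball\<close>.\<close>
  also have "\<dots> \<le> (\<integral>\<^sup>+ \<tau>. (ennreal c * P) * (ennreal (norm \<tau> powr - (1 - \<delta>)) * indicator (ball (0::real) 2) \<tau>) \<partial>lborel)"
  proof (intro nn_integral_mono_AE)
    have "(\<integral>\<^sup>+ y. ennreal (\<phi> (y - x)) * (G (x + \<tau> *\<^sub>R (y - x)) * indicator {0..1} \<tau>) \<partial>lborel)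
      \<le> (ennreal c * P) * (ennreal (norm \<tau> powr - (1 - \<delta>)) * indicator (ball (0::real) 2) \<tau>)"
      if "\<tau> \<noteq> 0" for \<tau> :: real
    proof (cases "\<tau> \<in> {0..1}")
      case True
      then have \<tau>: "0 < \<tau>" "\<tau> \<le> 1" using that by auto
      define a where "a y = (if y \<in> ball z (2 * r) then n + \<delta> - 1 else N - 1)" for y
      have sub: "\<tau> powr - n * \<phi> ((1 / \<tau>) *\<^sub>R u) \<le> c * \<tau> powr - (1 - \<delta>) * (norm u / r) powr - a (x + u)" for u
      proof (cases "u = 0")
        case False
        \<comment> \<open>One more than the exponent of the potential: the increment of
          \<open>f\<close> contributes a factor \<open>norm u\<close>, which uses up one power of
          the kernel decay.\<close>
        define b where "b = a (x + u) + 1"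
        have b: "n + \<delta> \<le> b" "b \<le> N" using N by (auto simp: b_def a_def n_def)
        define d where "d = norm u / \<tau>"
        have d: "d > 0" using False \<tau> by (simp add: d_def)
        have "\<rho> powr - n * (1 + d / \<rho>) powr - N \<le> r powr - n * 2 powr (j * - \<delta>) * (d / r) powr - b"
          unfolding \<rho>_def using r d j b \<delta> by (intro scaled_decay_le) (auto simp: n_def)
        also have "(d / r) powr - b = (norm u / r) powr - b * \<tau> powr b"
          using \<tau> r by (simp add: d_def powr_divide powr_mult powr_minus field_simps)
        finally have "\<rho> powr - n * (1 + d / \<rho>) powr - N * (C * (\<tau> powr - n * d)) \<le>
          r powr - n * 2 powr (j * - \<delta>) * ((norm u / r) powr - b * \<tau> powr b) * (C * (\<tau> powr - n * d))"
          using C d by (intro mult_right_mono) auto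
        also have "\<tau> powr b * \<tau> powr - n * d = norm u * \<tau> powr (b - n - 1)"
          using \<tau> by (simp add: d_def powr_diff powr_add powr_minus field_simps)
        then have "r powr - n * 2 powr (j * - \<delta>) * ((norm u / r) powr - b * \<tau> powr b) * (C * (\<tau> powr - n * d))
          = C * (r powr - n * norm u * (norm u / r) powr - b) * 2 powr (- j * \<delta>) * \<tau> powr (b - n - 1)"
          by (simp add: mult_ac)
        also have "r powr - n * norm u * (norm u / r) powr - b = r powr (1 - n) * (norm u / r) powr (1 - b)"
          using False r by (simp add: powr_diff powr_minus field_simps)
        \<comment> \<open>Here \<open>b \<ge> n + \<delta>\<close> and \<open>\<tau> \<le> 1\<close>
          are used: the Jacobian and the rescaled kernel leave
          \<open>\<tau> powr (b - n - 1)\<close>, at most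
          \<open>\<tau> powr (\<delta> - 1)\<close>.\<close>
        also have "C * (r powr (1 - n) * (norm u / r) powr (1 - b)) * 2 powr (- j * \<delta>) * \<tau> powr (b - n - 1)
          \<le> C * (r powr (1 - n) * (norm u / r) powr (1 - b)) * 2 powr (- j * \<delta>) * \<tau> powr - (1 - \<delta>)"
          using C \<tau> b by (intro mult_left_mono powr_mono') auto
        finally show ?thesis
          unfolding \<phi>_def using \<tau> by (simp add: c_def d_def b_def mult_ac)
      qed (simp add: \<phi>_def)
      have "(\<integral>\<^sup>+ y. ennreal (\<phi> (y - x)) * (G (x + \<tau> *\<^sub>R (y - x)) * indicator {0..1} \<tau>) \<partial>lborel)
        = (\<integral>\<^sup>+ y. ennreal (\<phi> (y - x)) * G (x + \<tau> *\<^sub>R (y - x)) \<partial>lborel)"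
        using True by simp
      also have "\<dots> = (\<integral>\<^sup>+ u. ennreal (\<bar>1 / \<tau>\<bar> ^ DIM('a)) *
          (ennreal (\<phi> ((x + (1 / \<tau>) *\<^sub>R u) - x)) * G (x + \<tau> *\<^sub>R ((x + (1 / \<tau>) *\<^sub>R u) - x))) \<partial>lborel)"
        using \<tau> by (intro nn_integral_lborel_affine) auto
      also have "\<dots> \<le> (\<integral>\<^sup>+ u. ennreal (c * \<tau> powr - (1 - \<delta>)) *
          (ennreal ((norm u / r) powr - a (x + u)) * G (x + u)) \<partial>lborel)"
      proof (intro nn_integral_mono)
        fix u
        have "\<bar>1 / \<tau>\<bar> ^ DIM('a) = \<tau> powr - n"
          using \<tau> by (simp add: n_def powr_minus powr_realpow power_divide divide_simps)
        then have "ennreal (\<bar>1 / \<tau>\<bar> ^ DIM('a)) * ennreal (\<phi> ((1 / \<tau>) *\<^sub>R u))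
          \<le> ennreal (c * \<tau> powr - (1 - \<delta>)) * ennreal ((norm u / r) powr - a (x + u))"
          using sub[of u] c C by (simp add: ennreal_mult[symmetric] \<phi>_def ennreal_leI)
        then show "ennreal (\<bar>1 / \<tau>\<bar> ^ DIM('a)) * (ennreal (\<phi> ((x + (1 / \<tau>) *\<^sub>R u) - x)) * G (x + \<tau> *\<^sub>R ((x + (1 / \<tau>) *\<^sub>R u) - x)))
          \<le> ennreal (c * \<tau> powr - (1 - \<delta>)) * (ennreal ((norm u / r) powr - a (x + u)) * G (x + u))"
          unfolding mult.assoc[symmetric] using \<tau> by (simp add: mult_right_mono)
      qed
      also have "\<dots> = ennreal (c * \<tau> powr - (1 - \<delta>)) *
          (\<integral>\<^sup>+ u. ennreal ((norm u / r) powr - a (x + u)) * G (x + u) \<partial>lborel)"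
        unfolding a_def mem_ball by (rule nn_integral_cmult) measurable
      also have "(\<integral>\<^sup>+ u. ennreal ((norm u / r) powr - a (x + u)) * G (x + u) \<partial>lborel) = P"
      proof -
        have [measurable]: "a \<in> borel_measurable borel" unfolding a_def[abs_def] mem_ball by measurable
        show ?thesis
          using nn_integral_lborel_translate[of "\<lambda>y. ennreal ((norm (x - y) / r) powr - a y) * G y" x]
          by (simp add: P_def potential_def a_def)
      qed
      finally show ?thesis
        using True c by (simp add: ennreal_mult mult_ac)
    qed simp
    then show "AE \<tau> in lborel. (\<integral>\<^sup>+ y. ennreal (\<phi> (y - x)) * (G (x + \<tau> *\<^sub>R (y - x)) * indicator {0..1} \<tau>) \<partial>lborel)
      \<le> (ennreal c * P) * (ennreal (norm \<tau> powr - (1 - \<delta>)) * indicator (ball (0::real) 2) \<tau>)"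
      using AE_lborel_singleton[of "0::real"] by (auto elim: eventually_mono)
  qed
  also have "\<dots> = (ennreal c * P) * (\<integral>\<^sup>+ \<tau>\<in>ball (0::real) 2. ennreal (norm \<tau> powr - (1 - \<delta>)) \<partial>lborel)"
    by (intro nn_integral_cmult borel_measurable_times_ennreal borel_measurable_indicator) auto
  finally show ?thesis by (simp only: c_def P_def G_def[abs_def] n_def mult_ac)
qed

text \<open>For fixed \<open>x\<close> and \<open>\<rho>\<close> the kernel profile is dominated by
  a multiple of \<open>(1 + norm y) powr - N\<close>, which is the weight in the definition of
  \<open>admissible\<close>.\<close>

lemma kernel_mult_integrable:
  fixes k :: "'a::euclidean_space \<Rightarrow> 'k::{real_normed_field,euclidean_space}" and \<rho> C \<epsilon> :: real
  assumes "\<rho> > 0" "0 \<le> C" "0 < \<epsilon>"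
    and k: "integrable lebesgue k" and f: "continuous_on UNIV f"
    and fin: "(\<integral>\<^sup>+ y. ennreal (norm (f y) * (1 + norm y) powr (- 2 * real DIM('a) - \<epsilon>)) \<partial>lebesgue) < \<infinity>"
    and bound: "\<And>y. norm (k y) \<le> C * (1 + norm (x - y) / \<rho>) powr - (2 * real DIM('a) + \<epsilon>)"
  shows "integrable lebesgue (\<lambda>y. k y * f y)"
proof (rule integrableI_bounded)
  define N where "N = 2 * real DIM('a) + \<epsilon>"
  have N: "N \<ge> 0" using assms by (simp add: N_def)
  \<comment> \<open>Chosen so that \<open>1 + norm y \<le> b * (1 + norm (x - y) / \<rho>)\<close>:
    the first factor recentres from \<open>x\<close> to the origin, the second removes the scale
    \<open>\<rho>\<close>.\<close>
  define b where "b = (1 + norm x) * (1 + \<rho>)"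
  have b: "b > 0" using assms by (simp add: b_def add_pos_nonneg)
  define K where "K = C * b powr N"
  have [measurable]: "f \<in> borel_measurable lebesgue" "k \<in> borel_measurable lebesgue"
    using f k by (auto intro: continuous_on_imp_lebesgue_measurable)
  show "(\<lambda>y. k y * f y) \<in> borel_measurable lebesgue" by measurable
  have pt: "norm (k y * f y) \<le> K * (norm (f y) * (1 + norm y) powr - N)" for y
  proof -
    have "1 + norm y \<le> (1 + norm x) * (1 + norm (x - y))"
      using norm_triangle_ineq4[of x "x - y"] mult_nonneg_nonneg[of "norm x" "norm (x - y)"]
      by (simp add: algebra_simps del: mult_nonneg_nonneg)
    also have "\<dots> \<le> (1 + norm x) * ((1 + \<rho>) * (1 + norm (x - y) / \<rho>))"
    proof (intro mult_left_mono)
      have "(1 + \<rho>) * (1 + norm (x - y) / \<rho>) = 1 + norm (x - y) + (\<rho> + norm (x - y) / \<rho>)"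
        using assms(1) by (simp add: field_simps)
      moreover have "0 \<le> \<rho> + norm (x - y) / \<rho>" using assms(1) by simp
      ultimately show "1 + norm (x - y) \<le> (1 + \<rho>) * (1 + norm (x - y) / \<rho>)" by linarith
    qed simp
    also have "\<dots> = (1 + norm (x - y) / \<rho>) * b" by (simp only: b_def mult_ac)
    finally have "(1 + norm y) / b \<le> 1 + norm (x - y) / \<rho>"
      by (simp only: pos_divide_le_eq[OF b])
    then have "(1 + norm (x - y) / \<rho>) powr - N \<le> ((1 + norm y) / b) powr - N"
      using b N by (intro powr_mono2') (auto simp: add_pos_nonneg)
    also have "\<dots> = b powr N * (1 + norm y) powr - N"
      using b by (simp add: powr_divide powr_minus field_simps)
    finally have "norm (k y) \<le> C * (b powr N * (1 + norm y) powr - N)"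
      using bound[of y] assms by (fold N_def) (erule order_trans, intro mult_left_mono, auto)
    then have "norm (k y) * norm (f y) \<le> C * (b powr N * (1 + norm y) powr - N) * norm (f y)"
      by (intro mult_right_mono) auto
    then show ?thesis by (simp add: norm_mult K_def mult_ac)
  qed
  have "(\<integral>\<^sup>+ y. ennreal (norm (k y * f y)) \<partial>lebesgue)
    \<le> (\<integral>\<^sup>+ y. ennreal K * ennreal (norm (f y) * (1 + norm y) powr - N) \<partial>lebesgue)"
    using assms b by (intro nn_integral_mono) (simp add: ennreal_mult[symmetric] K_def ennreal_leI pt[unfolded K_def])
  also have "\<dots> = ennreal K * (\<integral>\<^sup>+ y. ennreal (norm (f y) * (1 + norm y) powr - N) \<partial>lebesgue)"
  proof (rule nn_integral_cmult)
    have "(\<lambda>y::'a. (1 + norm y) powr - N) \<in> borel_measurable lebesgue"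
      by (intro continuous_on_imp_lebesgue_measurable continuous_intros) (auto simp: add_nonneg_eq_0_iff)
    then show "(\<lambda>y. ennreal (norm (f y) * (1 + norm y) powr - N)) \<in> borel_measurable lebesgue"
      by measurable
  qed
  also have "\<dots> < \<infinity>"
    using fin by (simp add: ennreal_mult_less_top N_def)
  finally show "(\<integral>\<^sup>+ y. ennreal (norm (k y * f y)) \<partial>lebesgue) < \<infinity>" .
qed

section \<open>Telescoping over dyadic scales\<close>

lemma sum_geometric_2_powr_le:
  fixes \<theta> :: real
  assumes "0 < \<theta>"
  shows "(\<Sum>j<N. 2 powr (- real j * \<theta>)) \<le> 1 / (1 - 2 powr - \<theta>)"
proof -
  have x: "0 < (2::real) powr - \<theta>" "2 powr - \<theta> < 1"
    using assms powr_less_mono[of "- \<theta>" 0 2] by auto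
  have "(\<Sum>j<N. 2 powr (- real j * \<theta>)) = (\<Sum>j<N. (2 powr - \<theta>) ^ j)"
    using x by (intro sum.cong refl) (simp add: powr_realpow[symmetric] powr_powr mult.commute)
  also have "\<dots> \<le> (\<Sum>j. (2 powr - \<theta>) ^ j)"
    using x by (intro sum_le_suminf) auto
  finally show ?thesis using x by (simp add: suminf_geometric)
qed

text \<open>
  The errors of one factor decay faster than the other factor may grow, so the products can be
  telescoped.
\<close>

lemma telescoping_product_bound:
  fixes a b :: "nat \<Rightarrow> 'k::real_normed_field" and \<delta>1 \<delta>2 \<kappa>1 \<kappa>2 :: real
  assumes "0 < \<delta>1" "0 < \<delta>2" "\<kappa>2 < \<delta>1" "\<kappa>1 < \<delta>2" "0 \<le> \<kappa>2"
    and a: "\<And>j. ennreal (norm (a j - as)) \<le> ennreal (2 powr (- real j * \<delta>1)) * Ua"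
    and b: "\<And>j. ennreal (norm (b j - bs)) \<le> ennreal (2 powr (- real j * \<delta>2)) * Ub"
    and a': "\<And>j. ennreal (norm (a j)) \<le> ennreal (2 powr (real j * \<kappa>1)) * Va"
    and b': "\<And>j. ennreal (norm (b j)) \<le> ennreal (2 powr (real j * \<kappa>2)) * Vb"
    and a0: "Va = 0 \<Longrightarrow> as = 0" and b0: "Vb = 0 \<Longrightarrow> bs = 0"
  defines "\<theta> \<equiv> min (\<delta>1 - \<kappa>2) (\<delta>2 - \<kappa>1)"
  shows "ennreal (norm (as * bs - a 0 * b 0)) \<le>
    ennreal (2 * 2 powr \<kappa>2 / (1 - 2 powr - \<theta>)) * (Ua * Vb + Va * Ub)"
proof -
  \<comment> \<open>The 2 comes from comparing consecutive terms through their common limit, and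
    \<open>2 powr \<kappa>2\<close> from the factor of \<open>b\<close> being taken at
    \<open>Suc j\<close>.\<close>
  define M where "M = 2 * 2 powr \<kappa>2"
  define K where "K = M / (1 - 2 powr - \<theta>)"
  have \<theta>: "\<theta> > 0" "\<theta> \<le> \<delta>1 - \<kappa>2" "\<theta> \<le> \<delta>2 - \<kappa>1" using assms by (auto simp: \<theta>_def)
  have th: "(2::real) powr - \<theta> < 1" using \<theta> powr_less_mono[of "- \<theta>" 0 2] by simp
  have M: "M \<ge> 2" using \<open>0 \<le> \<kappa>2\<close> by (simp add: M_def ge_one_powr_ge_zero)
  have K: "K > 0" using M th by (simp add: K_def)
  define T where "T = Ua * Vb + Va * Ub"
  have diff: "ennreal (norm (c (Suc j) - c j)) \<le> ennreal (2 * 2 powr (- real j * \<delta>)) * U"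
    if c: "\<And>j. ennreal (norm (c j - cs)) \<le> ennreal (2 powr (- real j * \<delta>)) * U" and "0 < \<delta>"
    for c :: "nat \<Rightarrow> 'k" and cs \<delta> U j
  proof -
    have "ennreal (norm (c (Suc j) - c j)) \<le> ennreal (norm (c (Suc j) - cs)) + ennreal (norm (c j - cs))"
      using norm_triangle_ineq4[of "c (Suc j) - cs" "c j - cs"]
      by (simp add: ennreal_plus[symmetric] ennreal_leI del: ennreal_plus)
    also have "\<dots> \<le> ennreal (2 powr (- real (Suc j) * \<delta>)) * U + ennreal (2 powr (- real j * \<delta>)) * U"
      by (intro add_mono c)
    also have "\<dots> \<le> ennreal (2 powr (- real j * \<delta>)) * U + ennreal (2 powr (- real j * \<delta>)) * U"
      using \<open>0 < \<delta>\<close> by (intro add_mono mult_right_mono ennreal_leI powr_mono) (auto simp: algebra_simps)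
    also have "\<dots> = ennreal (2 * 2 powr (- real j * \<delta>)) * U"
      by (simp add: ennreal_mult mult_2[symmetric] mult.assoc)
    finally show ?thesis .
  qed
  have step: "ennreal (norm (a (Suc j) * b (Suc j) - a j * b j)) \<le> ennreal (M * 2 powr (- real j * \<theta>)) * T" for j
  proof -
    have "a (Suc j) * b (Suc j) - a j * b j = (a (Suc j) - a j) * b (Suc j) + a j * (b (Suc j) - b j)"
      by (simp add: algebra_simps)
    then have "norm (a (Suc j) * b (Suc j) - a j * b j)
        \<le> norm (a (Suc j) - a j) * norm (b (Suc j)) + norm (a j) * norm (b (Suc j) - b j)"
      by (metis norm_mult norm_triangle_ineq)
    then have "ennreal (norm (a (Suc j) * b (Suc j) - a j * b j))
        \<le> ennreal (norm (a (Suc j) - a j)) * ennreal (norm (b (Suc j)))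
          + ennreal (norm (a j)) * ennreal (norm (b (Suc j) - b j))"
      by (simp add: ennreal_plus[symmetric] ennreal_mult[symmetric] ennreal_leI del: ennreal_plus)
    also have "\<dots> \<le> (ennreal (2 * 2 powr (- real j * \<delta>1)) * Ua) * (ennreal (2 powr (real (Suc j) * \<kappa>2)) * Vb)
        + (ennreal (2 powr (real j * \<kappa>1)) * Va) * (ennreal (2 * 2 powr (- real j * \<delta>2)) * Ub)"
      using assms(1,2) by (intro add_mono mult_mono diff[OF a] diff[OF b] a' b') auto
    also have "\<dots> = ennreal (2 * 2 powr (- real j * \<delta>1) * 2 powr (real (Suc j) * \<kappa>2)) * (Ua * Vb)
        + ennreal (2 powr (real j * \<kappa>1) * (2 * 2 powr (- real j * \<delta>2))) * (Va * Ub)"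
      by (simp only: ennreal_mult powr_ge_zero mult_nonneg_nonneg zero_le_numeral mult_ac)
    also have "\<dots> \<le> ennreal (M * 2 powr (- real j * \<theta>)) * (Ua * Vb) + ennreal (M * 2 powr (- real j * \<theta>)) * (Va * Ub)"
    proof (intro add_mono mult_right_mono ennreal_leI)
      have "real j * \<theta> \<le> real j * (\<delta>1 - \<kappa>2)" using \<theta> by (intro mult_left_mono) auto
      then have "- real j * \<delta>1 + real (Suc j) * \<kappa>2 \<le> \<kappa>2 + - real j * \<theta>" by (simp add: algebra_simps)
      then have "(2::real) powr (- real j * \<delta>1 + real (Suc j) * \<kappa>2) \<le> 2 powr (\<kappa>2 + - real j * \<theta>)"
        by (intro powr_mono) auto
      then show "2 * 2 powr (- real j * \<delta>1) * 2 powr (real (Suc j) * \<kappa>2) \<le> M * 2 powr (- real j * \<theta>)"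
        unfolding powr_add M_def mult.assoc by (intro mult_left_mono) auto
      have "real j * \<theta> \<le> real j * (\<delta>2 - \<kappa>1)" using \<theta> by (intro mult_left_mono) auto
      then have "real j * \<kappa>1 + - real j * \<delta>2 \<le> - real j * \<theta>" by (simp add: algebra_simps)
      then have "(2::real) powr (real j * \<kappa>1 + - real j * \<delta>2) \<le> 2 powr (- real j * \<theta>)"
        by (intro powr_mono) auto
      then have "2 * (2 powr (real j * \<kappa>1) * 2 powr (- real j * \<delta>2)) \<le> M * 2 powr (- real j * \<theta>)"
        unfolding powr_add using M by (intro mult_mono) auto
      then show "2 powr (real j * \<kappa>1) * (2 * 2 powr (- real j * \<delta>2)) \<le> M * 2 powr (- real j * \<theta>)"
        by (simp only: mult_ac)
    qed auto
    finally show ?thesis by (simp only: T_def distrib_left)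
  qed
  have sum: "ennreal (norm (a N * b N - a 0 * b 0)) \<le> ennreal (\<Sum>j<N. M * 2 powr (- real j * \<theta>)) * T" for N
  proof (induction N)
    case (Suc N)
    have "ennreal (norm (a (Suc N) * b (Suc N) - a 0 * b 0))
      \<le> ennreal (norm (a N * b N - a 0 * b 0)) + ennreal (norm (a (Suc N) * b (Suc N) - a N * b N))"
      using norm_triangle_ineq[of "a N * b N - a 0 * b 0" "a (Suc N) * b (Suc N) - a N * b N"]
      by (simp add: ennreal_plus[symmetric] ennreal_leI del: ennreal_plus)
    also have "\<dots> \<le> ennreal (\<Sum>j<N. M * 2 powr (- real j * \<theta>)) * T + ennreal (M * 2 powr (- real N * \<theta>)) * T"
      by (intro add_mono Suc step)
    also have "\<dots> = ennreal (\<Sum>j<Suc N. M * 2 powr (- real j * \<theta>)) * T"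
      using M by (simp add: distrib_right[symmetric] ennreal_plus[symmetric] sum_nonneg del: ennreal_plus)
    finally show ?case .
  qed simp
  have sumK: "ennreal (norm (a N * b N - a 0 * b 0)) \<le> ennreal K * T" for N
  proof -
    have "(\<Sum>j<N. M * 2 powr (- real j * \<theta>)) \<le> K"
      using mult_left_mono[OF sum_geometric_2_powr_le[OF \<theta>(1), of N], of M] M
      by (simp add: K_def sum_distrib_left)
    then show ?thesis by (intro order_trans[OF sum] mult_right_mono ennreal_leI) auto
  qed
  have lim: "c \<longlonglongrightarrow> cs"
    if c: "\<And>j. ennreal (norm (c j - cs)) \<le> ennreal (2 powr (- real j * \<delta>)) * U" and "0 < \<delta>" "U \<noteq> top"
    for c :: "nat \<Rightarrow> 'k" and cs \<delta> U
  proof -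
    obtain u where u: "0 \<le> u" "U = ennreal u" using \<open>U \<noteq> top\<close> by (cases U) auto
    have "norm (c j - cs) \<le> (2 powr - \<delta>) ^ j * u" for j
    proof -
      have "2 powr (- real j * \<delta>) = (2 powr - \<delta>) ^ j"
        by (simp add: powr_realpow[symmetric] powr_powr mult.commute)
      then show ?thesis using c[of j] u by (simp add: ennreal_mult[symmetric])
    qed
    moreover have "(\<lambda>j. (2 powr - \<delta>) ^ j * u) \<longlonglongrightarrow> 0"
      using \<open>0 < \<delta>\<close> powr_less_mono[of "- \<delta>" 0 2]
      by (intro tendsto_mult_left_zero LIMSEQ_power_zero) auto
    ultimately have "(\<lambda>j. c j - cs) \<longlonglongrightarrow> 0"
      by (intro Lim_null_comparison[of "\<lambda>j. c j - cs" "\<lambda>j. (2 powr - \<delta>) ^ j * u"] always_eventually) auto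
    then show ?thesis by (simp add: LIM_zero_iff)
  qed
  have "ennreal (norm (as * bs - a 0 * b 0)) \<le> ennreal K * T"
  proof (cases "T = top")
    case True
    then show ?thesis using K by (simp add: ennreal_mult_top)
  next
    case False
    then have fin: "Ua * Vb \<noteq> top" "Va * Ub \<noteq> top" by (auto simp: T_def)
    \<comment> \<open>A finite \<open>T\<close> does not force finite errors: \<open>Ua\<close> may
      be \<open>top\<close> if \<open>Vb\<close> is 0. The hypotheses \<open>a0\<close> and
      \<open>b0\<close> settle these cases, as then one factor vanishes both at scale 0 and in the
      limit. Otherwise both errors are finite and the sequences converge.\<close>
    consider "Va = 0" | "Vb = 0" | "Ua \<noteq> top" "Ub \<noteq> top"
      using fin by (auto simp: ennreal_mult_eq_top_iff)
    then show ?thesis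
    proof cases
      case 1
      then have "a 0 = 0" "as = 0" using a0 a'[of 0] by auto
      then show ?thesis by simp
    next
      case 2
      then have "b 0 = 0" "bs = 0" using b0 b'[of 0] by auto
      then show ?thesis by simp
    next
      case 3
      obtain t where t: "0 \<le> t" "T = ennreal t" using False by (cases T) auto
      have "(\<lambda>N. norm (a N * b N - a 0 * b 0)) \<longlonglongrightarrow> norm (as * bs - a 0 * b 0)"
        using 3 assms(1,2) by (intro tendsto_intros lim[OF a] lim[OF b]) auto
      moreover have "norm (a N * b N - a 0 * b 0) \<le> K * t" for N
        using sumK[of N] t K by (simp add: ennreal_mult[symmetric])
      ultimately have "norm (as * bs - a 0 * b 0) \<le> K * t"
        by (intro LIMSEQ_le_const2) auto
      then show ?thesis using t K by (simp add: ennreal_mult[symmetric] ennreal_leI)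
    qed
  qed
  then show ?thesis by (simp only: K_def M_def T_def)
qed

lemma AE_lborel_eq_0_imp_eq_0:
  fixes f :: "'a::euclidean_space \<Rightarrow> 'b::real_normed_vector"
  assumes "continuous_on UNIV f" "AE y in lborel. f y = 0"
  shows "f x = 0"
proof -
  have "open {y. f y \<noteq> 0}"
    using assms(1) by (intro open_Collect_neq continuous_on_const)
  moreover have "negligible {y. f y \<noteq> 0}"
  proof -
    have "AE y in lebesgue. f y = 0"
      using assms(2) by (rule AE_completion)
    moreover have "{y. f y \<noteq> 0} \<in> sets lebesgue"
      using \<open>open {y. f y \<noteq> 0}\<close> by (intro sets_completionI_sets) simp
    ultimately show ?thesis
      by (subst negligible_iff_null_sets) (auto simp: AE_iff_null)
  qed
  ultimately show ?thesis
    using open_not_negligible by blast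
qed

text \<open>The kernel is positive off the diagonal, so \<open>f\<close> vanishes almost everywhere,
  hence everywhere by continuity. This supplies the degenerate cases \<open>Va = 0\<close> and
  \<open>Vb = 0\<close> of the telescoping argument.\<close>

lemma potential_eq_0_imp_eq_0:
  fixes f :: "'a::euclidean_space \<Rightarrow> 'b::euclidean_space"
  assumes "r > 0" and f: "continuous_on UNIV f" and 0: "potential b c z r (\<lambda>y. ennreal (norm (f y))) x = 0"
  shows "f x = 0"
proof (rule AE_lborel_eq_0_imp_eq_0[OF f])
  have [measurable]: "f \<in> borel_measurable borel" by (rule borel_measurable_continuous_onI[OF f])
  have [measurable]: "(\<lambda>y. ennreal ((norm (x - y) / r) powr (- (if y \<in> ball z (2 * r) then b else c))) * ennreal (norm (f y)))
      \<in> borel_measurable lborel"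
    unfolding mem_ball by measurable
  have "AE y in lborel. ennreal ((norm (x - y) / r) powr (- (if y \<in> ball z (2 * r) then b else c))) * ennreal (norm (f y)) = 0"
    using 0 unfolding potential_def by (subst (asm) nn_integral_0_iff_AE) auto
  with AE_lborel_singleton[of x] show "AE y in lborel. f y = 0"
    by eventually_elim (use \<open>r > 0\<close> in auto)
qed

section \<open>The product error and its Lebesgue norm\<close>

text \<open>Telescoping at a fixed point \<open>x\<close> with \<open>S f j\<close> and
  \<open>S g j\<close>, where \<open>j = 0\<close> is the time \<open>r powr m\<close>. Errors carry
  \<open>r powr (1 - n)\<close> and sizes \<open>r powr - n\<close>, which multiply to
  \<open>r powr (1 - 2 * n)\<close>.\<close>

lemma product_error_le_potential:
  fixes p :: "real \<Rightarrow> 'a::euclidean_space \<Rightarrow> 'a \<Rightarrow> 'k::{real_normed_field,euclidean_space}"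
    and m \<epsilon> \<delta>1 \<delta>2 \<kappa>1 \<kappa>2 :: real
  assumes "m > 0" "\<epsilon> > 0" and p: "approx_identity m \<epsilon> p"
    and \<delta>: "0 < \<delta>1" "\<delta>1 \<le> 1" "0 < \<delta>2" "\<delta>2 \<le> 1"
    and \<kappa>: "0 \<le> \<kappa>1" "\<kappa>1 < \<delta>2" "0 \<le> \<kappa>2" "\<kappa>2 < \<delta>1"
  defines "n \<equiv> real DIM('a)" and "N \<equiv> 2 * real DIM('a) + \<epsilon>"
  shows "\<exists>C>0. \<forall>(z::'a) r f g x. r > 0 \<longrightarrow> admissible \<epsilon> f g \<longrightarrow>
    ennreal (norm (f x * g x - kernel_op (p (r powr m)) f x * kernel_op (p (r powr m)) g x))
    \<le> ennreal (C * r powr (1 - 2 * n)) *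
      (potential (n + \<delta>1 - 1) (N - 1) z r (\<lambda>y. ennreal (grad_norm f y)) x *
         potential (n - \<kappa>2) N z r (\<lambda>y. ennreal (norm (g y))) x +
       potential (n - \<kappa>1) N z r (\<lambda>y. ennreal (norm (f y))) x *
         potential (n + \<delta>2 - 1) (N - 1) z r (\<lambda>y. ennreal (grad_norm g y)) x)"
proof -
  have n1: "1 \<le> n" using DIM_positive[where 'a='a] by (simp add: n_def Suc_le_eq)
  have nN: "n + 1 \<le> N" using n1 \<open>\<epsilon> > 0\<close> unfolding n_def N_def by linarith
  have "\<exists>C>0. \<forall>\<rho>>0. \<forall>x y. norm (p (\<rho> powr m) x y) \<le> C * \<rho> powr - n * (1 + norm (x - y) / \<rho>) powr - N"
    unfolding n_def N_def using p assms(1,2)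
    by (intro kernel_bound_decay) (auto simp: approx_identity_def)
  then obtain C0 where C0: "C0 > 0" "\<And>\<rho> x y. \<rho> > 0 \<Longrightarrow>
      norm (p (\<rho> powr m) x y) \<le> C0 * \<rho> powr - n * (1 + norm (x - y) / \<rho>) powr - N"
    by auto
  \<comment> \<open>The integral over the segment parameter; it is finite because the singularity
    has order \<open>1 - \<delta> < 1\<close> on the line.\<close>
  define I where "I \<delta> = (\<integral>\<^sup>+ \<tau>\<in>ball (0::real) 2. ennreal (norm \<tau> powr - (1 - \<delta>)) \<partial>lborel)" for \<delta>
  have I_finite: "\<exists>c\<ge>0. I \<delta> \<le> ennreal c" if "0 < \<delta>" "\<delta> \<le> 1" for \<delta>
  proof -
    have "\<exists>C>0. \<forall>R>0. (\<integral>\<^sup>+ u\<in>ball (0::real) R. ennreal (norm u powr - (1 - \<delta>)) \<partial>lborel)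
      \<le> ennreal (C * R powr (DIM(real) - (1 - \<delta>)))"
      using that by (intro nn_integral_norm_powr_ball) auto
    then obtain C where "C > 0" "\<forall>R>0. (\<integral>\<^sup>+ u\<in>ball (0::real) R. ennreal (norm u powr - (1 - \<delta>)) \<partial>lborel)
      \<le> ennreal (C * R powr (DIM(real) - (1 - \<delta>)))"
      by (elim exE conjE)
    from this(1) this(2)[rule_format, of 2]
    show ?thesis
      unfolding I_def by (intro exI[of _ "C * 2 powr (DIM(real) - (1 - \<delta>))"]) simp
  qed
  obtain c1 where c1: "c1 \<ge> 0" "I \<delta>1 \<le> ennreal c1" using I_finite \<delta> by blast
  obtain c2 where c2: "c2 \<ge> 0" "I \<delta>2 \<le> ennreal c2" using I_finite \<delta> by blast
  \<comment> \<open>One constant above \<open>C0\<close>, \<open>C0 * c1\<close> and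
    \<open>C0 * c2\<close>, so that all four error and size bounds share it.\<close>
  define E where "E = C0 * (1 + c1 + c2)"
  have E: "E > 0" using C0 c1 c2 by (simp add: E_def add_pos_nonneg)
  have E': "C0 \<le> E" "C0 * c1 \<le> E" "C0 * c2 \<le> E"
    using C0(1) c1(1) c2(1) by (auto simp: E_def distrib_left)
  define \<theta> where "\<theta> = min (\<delta>1 - \<kappa>2) (\<delta>2 - \<kappa>1)"
  have \<theta>: "\<theta> > 0" using \<kappa> by (simp add: \<theta>_def)
  define K where "K = 2 * 2 powr \<kappa>2 / (1 - 2 powr - \<theta>)"
  have K: "K > 0" using \<theta> powr_less_mono[of "- \<theta>" 0 2] by (simp add: K_def)
  have "ennreal (norm (f x * g x - kernel_op (p (r powr m)) f x * kernel_op (p (r powr m)) g x))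
    \<le> ennreal (K * (E * E) * r powr (1 - 2 * n)) *
      (potential (n + \<delta>1 - 1) (N - 1) z r (\<lambda>y. ennreal (grad_norm f y)) x *
         potential (n - \<kappa>2) N z r (\<lambda>y. ennreal (norm (g y))) x +
       potential (n - \<kappa>1) N z r (\<lambda>y. ennreal (norm (f y))) x *
         potential (n + \<delta>2 - 1) (N - 1) z r (\<lambda>y. ennreal (grad_norm g y)) x)"
    if r: "r > 0" and adm: "admissible \<epsilon> f g" for z x :: 'a and r and f g :: "'a \<Rightarrow> 'k"
  proof -
    define \<rho> where "\<rho> j = r * 2 powr - real j" for j
    have \<rho>: "\<rho> j > 0" for j using r by (simp add: \<rho>_def)
    define S where "S h j = kernel_op (p (\<rho> j powr m)) h x" for h :: "'a \<Rightarrow> 'k" and j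
    define U where "U \<delta> h = potential (n + \<delta> - 1) (N - 1) z r (\<lambda>y. ennreal (grad_norm h y)) x" for \<delta> and h :: "'a \<Rightarrow> 'k"
    define V where "V \<kappa> h = potential (n - \<kappa>) N z r (\<lambda>y. ennreal (norm (h y))) x" for \<kappa> and h :: "'a \<Rightarrow> 'k"
    have one: "integral\<^sup>L lebesgue (p (\<rho> j powr m) x) = 1" for j
      using p \<rho>[of j] by (simp add: approx_identity_def)
    have bound: "norm (p (\<rho> j powr m) x y) \<le> C0 * (r * 2 powr - real j) powr - real DIM('a) *
        (1 + norm (x - y) / (r * 2 powr - real j)) powr - N" for j y
      using C0(2)[OF \<rho>[of j], of x y] by (simp add: \<rho>_def n_def)
    have C1: "C1_fun f" "C1_fun g" using adm by (auto simp: admissible_def)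
    have int: "integrable lebesgue (\<lambda>y. p (\<rho> j powr m) x y * h y)" if "h = f \<or> h = g" for h j
    proof (rule kernel_mult_integrable[where \<rho> = "\<rho> j" and C = "C0 * \<rho> j powr - n" and \<epsilon> = \<epsilon> and x = x])
      show "integrable lebesgue (p (\<rho> j powr m) x)"
        using one[of j] not_integrable_integral_eq[of lebesgue "p (\<rho> j powr m) x"] by fastforce
      show "continuous_on UNIV h" using C1 that C1_fun_continuous_on by blast
      have "(\<integral>\<^sup>+ y. ennreal (norm (h y) * (1 + norm y) powr (- 2 * real DIM('a) - \<epsilon>)) \<partial>lebesgue)
        \<le> (\<integral>\<^sup>+ y. ennreal ((norm (f y) + norm (g y)) * (1 + norm y) powr (- 2 * real DIM('a) - \<epsilon>)) \<partial>lebesgue)"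
        using that by (intro nn_integral_mono ennreal_leI mult_right_mono) auto
      also have "\<dots> < \<infinity>" using adm by (simp add: admissible_def)
      finally show "(\<integral>\<^sup>+ y. ennreal (norm (h y) * (1 + norm y) powr (- 2 * real DIM('a) - \<epsilon>)) \<partial>lebesgue) < \<infinity>" .
      show "norm (p (\<rho> j powr m) x y) \<le> C0 * \<rho> j powr - n * (1 + norm (x - y) / \<rho> j) powr - (2 * real DIM('a) + \<epsilon>)" for y
        using C0(2)[OF \<rho>[of j], of x y] by (simp add: N_def)
    qed (use \<rho> C0 \<open>\<epsilon> > 0\<close> in auto)
    have err: "ennreal (norm (S h j - h x)) \<le> ennreal (2 powr (- real j * \<delta>)) * (ennreal (E * r powr (1 - n)) * U \<delta> h)"
      if h: "h = f \<or> h = g" and \<delta>: "0 < \<delta>" "\<delta> \<le> 1" and c: "0 \<le> c" "I \<delta> \<le> ennreal c" "C0 * c \<le> E" for h j \<delta> c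
    proof -
      have "ennreal (norm (S h j - h x)) \<le> ennreal (C0 * r powr (1 - real DIM('a)) * 2 powr (- real j * \<delta>)) * I \<delta> *
        potential (DIM('a) + \<delta> - 1) (N - 1) z r (\<lambda>y. ennreal (grad_norm h y)) x"
        unfolding S_def I_def using C0(1) r \<delta> h C1 nN
        by (intro kernel_op_diff_le_potential one int bound) (auto simp: n_def)
      also have "\<dots> \<le> ennreal (C0 * r powr (1 - n) * 2 powr (- real j * \<delta>)) * ennreal c * U \<delta> h"
        unfolding U_def n_def by (intro mult_right_mono mult_left_mono c) auto
      also have "\<dots> \<le> ennreal (2 powr (- real j * \<delta>) * (E * r powr (1 - n))) * U \<delta> h"
      proof (intro mult_right_mono)
        have "C0 * c * (r powr (1 - n) * 2 powr (- real j * \<delta>)) \<le> E * (r powr (1 - n) * 2 powr (- real j * \<delta>))"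
          using c by (intro mult_right_mono) auto
        then show "ennreal (C0 * r powr (1 - n) * 2 powr (- real j * \<delta>)) * ennreal c
            \<le> ennreal (2 powr (- real j * \<delta>) * (E * r powr (1 - n)))"
          using C0(1) c(1) by (simp add: ennreal_mult[symmetric] ennreal_leI mult_ac)
      qed auto
      also have "\<dots> = ennreal (2 powr (- real j * \<delta>)) * (ennreal (E * r powr (1 - n)) * U \<delta> h)"
        using E by (simp add: ennreal_mult mult.assoc)
      finally show ?thesis .
    qed
    have size: "ennreal (norm (S h j)) \<le> ennreal (2 powr (real j * \<kappa>)) * (ennreal (E * r powr - n) * V \<kappa> h)"
      if h: "h = f \<or> h = g" and \<kappa>: "0 \<le> \<kappa>" "\<kappa> \<le> 1" for h j \<kappa>
    proof -
      have [measurable]: "h \<in> borel_measurable borel"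
        using h C1 by (auto intro!: borel_measurable_continuous_onI C1_fun_continuous_on)
      have "\<kappa> \<le> real DIM('a)" using \<kappa> n1 unfolding n_def by linarith
      then have "ennreal (norm (S h j)) \<le> ennreal (C0 * r powr - real DIM('a) * 2 powr (real j * \<kappa>)) *
        potential (DIM('a) - \<kappa>) N z r (\<lambda>y. ennreal (norm (h y))) x"
        unfolding S_def using C0(1) r \<kappa> nN n1
        by (intro kernel_op_le_potential bound) (auto simp: n_def)
      also have "\<dots> \<le> ennreal (2 powr (real j * \<kappa>) * (E * r powr - n)) * V \<kappa> h"
      proof -
        have "C0 * (r powr - n * 2 powr (real j * \<kappa>)) \<le> E * (r powr - n * 2 powr (real j * \<kappa>))"
          using E' by (intro mult_right_mono) auto
        then show ?thesis
          unfolding V_def n_def by (intro mult_right_mono ennreal_leI) (auto simp: mult_ac)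
      qed
      also have "\<dots> = ennreal (2 powr (real j * \<kappa>)) * (ennreal (E * r powr - n) * V \<kappa> h)"
        using E by (simp add: ennreal_mult mult.assoc)
      finally show ?thesis .
    qed
    have zero: "h x = 0" if h: "h = f \<or> h = g" and "ennreal (E * r powr - n) * V \<kappa> h = 0" for h \<kappa>
    proof -
      have "V \<kappa> h = 0" using that E r by simp
      moreover have "continuous_on UNIV h" using h C1 C1_fun_continuous_on by blast
      ultimately show ?thesis
        unfolding V_def using potential_eq_0_imp_eq_0[OF r] by blast
    qed
    have "ennreal (norm (f x * g x - S f 0 * S g 0)) \<le> ennreal K *
      ((ennreal (E * r powr (1 - n)) * U \<delta>1 f) * (ennreal (E * r powr - n) * V \<kappa>2 g) +
       (ennreal (E * r powr - n) * V \<kappa>1 f) * (ennreal (E * r powr (1 - n)) * U \<delta>2 g))"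
      unfolding K_def \<theta>_def
    proof (rule telescoping_product_bound)
      show "ennreal (norm (S f j - f x)) \<le> ennreal (2 powr (- real j * \<delta>1)) * (ennreal (E * r powr (1 - n)) * U \<delta>1 f)" for j
        using \<delta> c1 E' by (intro err[where c = c1]) auto
      show "ennreal (norm (S g j - g x)) \<le> ennreal (2 powr (- real j * \<delta>2)) * (ennreal (E * r powr (1 - n)) * U \<delta>2 g)" for j
        using \<delta> c2 E' by (intro err[where c = c2]) auto
    qed (use \<delta> \<kappa> size zero in auto)
    also have "\<dots> = ennreal (K * (E * E) * (r powr (1 - n) * r powr - n)) * (U \<delta>1 f * V \<kappa>2 g + V \<kappa>1 f * U \<delta>2 g)"
      using E K by (simp add: ennreal_mult distrib_left mult_ac)
    also have "r powr (1 - n) * r powr - n = r powr (1 - 2 * n)"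
      by (simp add: powr_add[symmetric])
    finally show ?thesis
      by (simp add: S_def \<rho>_def U_def V_def)
  qed
  moreover have "K * (E * E) > 0" using K E by simp
  ultimately show ?thesis by (intro exI[of _ "K * (E * E)"] conjI allI impI)
qed

text \<open>Valid for arbitrary \<open>f\<close>. This matters because
  \<open>kernel_op (p t) f\<close> is not known to be measurable in \<open>x\<close>.\<close>

lemma Lp_norm_on_eq_enn_Lp: "Lp_norm_on p A f = enn_Lp p A (\<lambda>x. ennreal (norm (f x)))"
proof -
  have "(\<integral>\<^sup>+ x\<in>A. ennreal (norm (f x) powr p) \<partial>lebesgue) = (\<integral>\<^sup>+ x\<in>A. ennpowr (ennreal (norm (f x))) p \<partial>lborel)"
    by (simp add: nn_integral_completion ennpowr_ennreal)
  then show ?thesis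
    unfolding Lp_norm_on_def enn_Lp_def Let_def infinity_ennreal_def by (simp only: ennpowr_def[of _ "1 / p"])
qed

text \<open>By monotonicity \<open>X k * Y l\<close> is at most the diagonal term at the larger
  index, hence at most the sum of both diagonal terms. The double series then reduces to two copies
  of the diagonal series times the total weight.\<close>

lemma ennreal_suminf_mult_suminf_le:
  fixes w X Y :: "nat \<Rightarrow> ennreal"
  assumes "mono X" "mono Y"
  shows "(\<Sum>k. w k * X k) * (\<Sum>l. w l * Y l) \<le> 2 * (\<Sum>k. w k) * (\<Sum>l. w l * (X l * Y l))"
proof -
  have XY: "X k * Y l \<le> X k * Y k + X l * Y l" for k l
  proof (cases "k \<le> l")
    case True
    have "X k * Y l \<le> X l * Y l" by (intro mult_right_mono monoD[OF assms(1) True]) simp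
    then show ?thesis by (simp add: add_increasing)
  next
    case False
    then have "l \<le> k" by simp
    then have "X k * Y l \<le> X k * Y k" by (intro mult_left_mono monoD[OF assms(2)]) simp_all
    then show ?thesis by (simp add: add_increasing2)
  qed
  define W where "W = (\<Sum>k. w k)"
  define Z where "Z = (\<Sum>l. w l * (X l * Y l))"
  have "(\<Sum>k. w k * X k) * (\<Sum>l. w l * Y l) = (\<Sum>k. \<Sum>l. (w k * X k) * (w l * Y l))"
    by (simp only: ennreal_suminf_cmult ennreal_suminf_multc)
  also have "\<dots> \<le> (\<Sum>k. \<Sum>l. w k * (X k * Y k) * w l + w k * (w l * (X l * Y l)))"
  proof (intro suminf_le)
    fix k l
    have "(w k * X k) * (w l * Y l) = w k * w l * (X k * Y l)" by (simp only: mult_ac)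
    also have "\<dots> \<le> w k * w l * (X k * Y k + X l * Y l)" by (intro mult_left_mono XY) auto
    also have "\<dots> = w k * (X k * Y k) * w l + w k * (w l * (X l * Y l))" by (simp only: distrib_left mult_ac)
    finally show "(w k * X k) * (w l * Y l) \<le> w k * (X k * Y k) * w l + w k * (w l * (X l * Y l))" .
  qed auto
  also have "\<dots> = (\<Sum>k. (\<Sum>l. w k * (X k * Y k) * w l) + (\<Sum>l. w k * (w l * (X l * Y l))))"
    by (intro suminf_cong suminf_add[symmetric] summableI)
  also have "\<dots> = (\<Sum>k. w k * (X k * Y k) * W + w k * Z)"
    by (simp only: ennreal_suminf_cmult W_def Z_def)
  also have "\<dots> = (\<Sum>k. w k * (X k * Y k) * W) + (\<Sum>k. w k * Z)"
    by (intro suminf_add[symmetric] summableI)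
  also have "\<dots> = Z * W + W * Z"
    by (simp only: ennreal_suminf_multc W_def Z_def)
  also have "\<dots> = 2 * W * Z" by (simp only: mult_2 distrib_right mult.commute[of Z])
  finally show ?thesis by (simp only: W_def Z_def)
qed

theorem theorem1:
  fixes p :: "real \<Rightarrow> 'a::euclidean_space \<Rightarrow> 'a \<Rightarrow> 'k::{real_normed_field,euclidean_space}"
    and m \<epsilon> p1 p2 q \<alpha> :: real
  assumes "m > 0" and "\<epsilon> > 0"
    and "approx_identity m \<epsilon> p"
    and "time_derivative_bound m \<epsilon> p"
    and "1 < p1" and "1 < p2" and "q > 0"
    and "0 < \<alpha>" and "\<alpha> < min 1 \<epsilon>"
    and "1 / q = 1 / p1 + 1 / p2 - (1 - \<alpha>) / real DIM('a)"
  shows "\<exists>C>0. \<forall>(z::'a) r. r > 0 \<longrightarrow> (\<forall>f g :: 'a \<Rightarrow> 'k. admissible \<epsilon> f g \<longrightarrow>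
    Lp_norm_on q (ball z r)
      (\<lambda>x. f x * g x - kernel_op (p (r powr m)) f x * kernel_op (p (r powr m)) g x)
    \<le> ennreal (C * r powr \<alpha>) *
      (\<Sum>l::nat. ennreal (2 powr (- real l * (\<epsilon> - \<alpha>))) *
        (Lp_norm_on p1 (ball z (2 ^ (l + 1) * r)) (grad_norm f) *
           Lp_norm_on p2 (ball z (2 ^ (l + 1) * r)) g +
         Lp_norm_on p1 (ball z (2 ^ (l + 1) * r)) f *
           Lp_norm_on p2 (ball z (2 ^ (l + 1) * r)) (grad_norm g))))"
proof -
  define n where "n = real DIM('a)"
  define N where "N = 2 * real DIM('a) + \<epsilon>"
  have n1: "1 \<le> n" using DIM_positive[where 'a='a] by (simp add: n_def Suc_le_eq)
  have \<alpha>: "0 < \<alpha>" "\<alpha> < 1" "\<alpha> < \<epsilon>" using assms by auto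
  \<comment> \<open>The loss \<open>1 - \<alpha>\<close> is divided in proportion to
    \<open>1 / p1\<close> and \<open>1 / p2\<close>. Both \<open>1 / q1\<close> and
    \<open>1 / q2\<close> are then positive multiples of \<open>1 / p1\<close> and
    \<open>1 / p2\<close> with the same factor, positive because \<open>1 / q > 0\<close>.\<close>
  define s1 where "s1 = (1 - \<alpha>) * (1 / p1) / (1 / p1 + 1 / p2)"
  define s2 where "s2 = (1 - \<alpha>) * (1 / p2) / (1 / p1 + 1 / p2)"
  define q1 where "q1 = 1 / (1 / p1 - s1 / n)"
  define q2 where "q2 = 1 / (1 / p2 - s2 / n)"
  have P: "1 / p1 > 0" "1 / p2 > 0" "1 / p1 + 1 / p2 > 0" using assms by (auto simp: add_pos_pos)
  have s: "s1 > 0" "s2 > 0" "s1 + s2 = 1 - \<alpha>"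
  proof -
    have "s1 + s2 = (1 - \<alpha>) * ((1 / p1 + 1 / p2) / (1 / p1 + 1 / p2))"
      by (simp only: s1_def s2_def distrib_left add_divide_distrib times_divide_eq_right)
    then show "s1 + s2 = 1 - \<alpha>" using P(3) by (simp only: divide_self_if) simp
    show "s1 > 0" "s2 > 0" unfolding s1_def s2_def using P \<alpha> by (intro divide_pos_pos mult_pos_pos; simp)+
  qed
  have "0 < 1 / q" using \<open>q > 0\<close> by simp
  then have "(1 - \<alpha>) / n < 1 / p1 + 1 / p2"
    unfolding assms(10) n_def by linarith
  then have small: "(1 - \<alpha>) / n / (1 / p1 + 1 / p2) < 1"
    unfolding pos_divide_less_eq[OF P(3)] by simp
  have "s1 / n = (1 / p1) * ((1 - \<alpha>) / n / (1 / p1 + 1 / p2))" by (simp add: s1_def)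
  also have "\<dots> < (1 / p1) * 1" using small P(1) by (intro mult_strict_left_mono)
  finally have q1: "1 / p1 - s1 / n > 0" by simp
  have "s2 / n = (1 / p2) * ((1 - \<alpha>) / n / (1 / p1 + 1 / p2))" by (simp add: s2_def)
  also have "\<dots> < (1 / p2) * 1" using small P(2) by (intro mult_strict_left_mono)
  finally have q2: "1 / p2 - s2 / n > 0" by simp
  have q: "q1 > 0" "q2 > 0" "1 / q1 = 1 / p1 - s1 / real DIM('a)" "1 / q2 = 1 / p2 - s2 / real DIM('a)"
    using q1 q2 by (simp_all add: q1_def q2_def n_def)
  have qq: "1 / q = 1 / q1 + 1 / q2"
    unfolding assms(10) q(3,4) s(3)[symmetric] by (simp add: add_divide_distrib)
  have dims: "real DIM('a) = n" by (simp add: n_def)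
  \<comment> \<open>The numbers are placed in the order
    \<open>s2 < \<kappa>2 < \<delta>1 < s2 + \<alpha>\<close>, and likewise above \<open>s1\<close>.
    The outer inequalities make the potentials subcritical, the middle one makes the telescoped
    series converge.\<close>
  define \<delta>1 where "\<delta>1 = s2 + \<alpha> / 2"
  define \<delta>2 where "\<delta>2 = s1 + \<alpha> / 2"
  define \<kappa>1 where "\<kappa>1 = s1 + \<alpha> / 4"
  define \<kappa>2 where "\<kappa>2 = s2 + \<alpha> / 4"
  note exps = \<delta>1_def \<delta>2_def \<kappa>1_def \<kappa>2_def
  \<comment> \<open>The far exponent \<open>N - 1\<close> of the gradient potentials still leaves
    \<open>n + \<epsilon>\<close> because \<open>2 * n - 1 \<ge> n\<close>.\<close>
  have Ns: "n + \<epsilon> \<le> N - 1" "n + \<epsilon> \<le> N" using n1 by (simp_all add: N_def n_def)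
  define W where "W p z r h = (\<Sum>l::nat. ennreal (2 powr (- real l * \<epsilon>)) * enn_Lp p (ball z (2 ^ (l + 1) * r)) h)"
    for p z r and h :: "'a \<Rightarrow> ennreal"
  define Lbound where "Lbound C p q s b c \<longleftrightarrow> (\<forall>(z::'a) r (h::'a \<Rightarrow> ennreal). r > 0 \<longrightarrow> h \<in> borel_measurable borel \<longrightarrow>
    enn_Lp q (ball z r) (potential b c z r h) \<le> ennreal (C * r powr (n - s)) * W p z r h)" for C p q s b c
  have "\<exists>C>0. Lbound C p1 q1 s1 (n + \<delta>1 - 1) (N - 1)"
    unfolding Lbound_def W_def n_def using assms(2,5) q s n1 \<alpha> Ns
    by (intro potential_Lp) (auto simp: exps dims)
  then obtain C1 where C1: "C1 > 0" "Lbound C1 p1 q1 s1 (n + \<delta>1 - 1) (N - 1)" by auto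
  have "\<exists>C>0. Lbound C p2 q2 s2 (n - \<kappa>2) N"
    unfolding Lbound_def W_def n_def using assms(2,6) q s n1 \<alpha> Ns
    by (intro potential_Lp) (auto simp: exps dims)
  then obtain C2 where C2: "C2 > 0" "Lbound C2 p2 q2 s2 (n - \<kappa>2) N" by auto
  have "\<exists>C>0. Lbound C p1 q1 s1 (n - \<kappa>1) N"
    unfolding Lbound_def W_def n_def using assms(2,5) q s n1 \<alpha> Ns
    by (intro potential_Lp) (auto simp: exps dims)
  then obtain C3 where C3: "C3 > 0" "Lbound C3 p1 q1 s1 (n - \<kappa>1) N" by auto
  have "\<exists>C>0. Lbound C p2 q2 s2 (n + \<delta>2 - 1) (N - 1)"
    unfolding Lbound_def W_def n_def using assms(2,6) q s n1 \<alpha> Ns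
    by (intro potential_Lp) (auto simp: exps dims)
  then obtain C4 where C4: "C4 > 0" "Lbound C4 p2 q2 s2 (n + \<delta>2 - 1) (N - 1)" by auto
  have "\<exists>C>0. \<forall>(z::'a) r f g x. r > 0 \<longrightarrow> admissible \<epsilon> f g \<longrightarrow>
    ennreal (norm (f x * g x - kernel_op (p (r powr m)) f x * kernel_op (p (r powr m)) g x))
    \<le> ennreal (C * r powr (1 - 2 * n)) *
      (potential (n + \<delta>1 - 1) (N - 1) z r (\<lambda>y. ennreal (grad_norm f y)) x *
         potential (n - \<kappa>2) N z r (\<lambda>y. ennreal (norm (g y))) x +
       potential (n - \<kappa>1) N z r (\<lambda>y. ennreal (norm (f y))) x *
         potential (n + \<delta>2 - 1) (N - 1) z r (\<lambda>y. ennreal (grad_norm g y)) x)"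
    unfolding n_def N_def using assms(1-3) s \<alpha>
    by (intro product_error_le_potential) (auto simp: exps)
  then obtain C0 where C0: "C0 > 0" and pointwise: "\<forall>(z::'a) r f g x. r > 0 \<longrightarrow> admissible \<epsilon> f g \<longrightarrow>
    ennreal (norm (f x * g x - kernel_op (p (r powr m)) f x * kernel_op (p (r powr m)) g x))
    \<le> ennreal (C0 * r powr (1 - 2 * n)) *
      (potential (n + \<delta>1 - 1) (N - 1) z r (\<lambda>y. ennreal (grad_norm f y)) x *
         potential (n - \<kappa>2) N z r (\<lambda>y. ennreal (norm (g y))) x +
       potential (n - \<kappa>1) N z r (\<lambda>y. ennreal (norm (f y))) x *
         potential (n + \<delta>2 - 1) (N - 1) z r (\<lambda>y. ennreal (grad_norm g y)) x)"
    by (elim exE conjE)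
  define E where "E = C1 * C2 + C3 * C4"
  define G where "G = 1 / (1 - 2 powr - \<epsilon>)"
  have E: "E > 0" using C1 C2 C3 C4 by (simp add: E_def add_pos_pos)
  have G: "G > 0" using \<open>\<epsilon> > 0\<close> powr_less_mono[of "- \<epsilon>" 0 2] by (simp add: G_def)
  have weights: "(\<Sum>l. ennreal (2 powr (- real l * \<epsilon>))) \<le> ennreal G"
  proof (rule suminf_le_const[OF summableI])
    fix k
    show "(\<Sum>l<k. ennreal (2 powr (- real l * \<epsilon>))) \<le> ennreal G"
      using sum_geometric_2_powr_le[OF \<open>\<epsilon> > 0\<close>, of k] by (simp add: G_def sum_ennreal ennreal_leI)
  qed
  define C where "C = C0 * 2 powr (1 + 1 / q) * (E * (2 * G))"
  have C: "C > 0" using C0 E G by (simp add: C_def)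
  have "Lp_norm_on q (ball z r) (\<lambda>x. f x * g x - kernel_op (p (r powr m)) f x * kernel_op (p (r powr m)) g x)
    \<le> ennreal (C * r powr \<alpha>) *
      (\<Sum>l::nat. ennreal (2 powr (- real l * (\<epsilon> - \<alpha>))) *
        (Lp_norm_on p1 (ball z (2 ^ (l + 1) * r)) (grad_norm f) *
           Lp_norm_on p2 (ball z (2 ^ (l + 1) * r)) g +
         Lp_norm_on p1 (ball z (2 ^ (l + 1) * r)) f *
           Lp_norm_on p2 (ball z (2 ^ (l + 1) * r)) (grad_norm g)))"
    if r: "r > 0" and adm: "admissible \<epsilon> f g" for z :: 'a and r and f g :: "'a \<Rightarrow> 'k"
  proof -
    define f0 where "f0 y = ennreal (norm (f y))" for y
    define g0 where "g0 y = ennreal (norm (g y))" for y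
    define f1 where "f1 y = ennreal (grad_norm f y)" for y
    define g1 where "g1 y = ennreal (grad_norm g y)" for y
    have cf: "C1_fun f" "C1_fun g" using adm by (auto simp: admissible_def)
    have meas [measurable]: "f0 \<in> borel_measurable borel" "g0 \<in> borel_measurable borel"
      "f1 \<in> borel_measurable borel" "g1 \<in> borel_measurable borel"
      unfolding f0_def[abs_def] g0_def[abs_def] f1_def[abs_def] g1_def[abs_def]
      by (intro measurable_compose[OF _ measurable_ennreal] borel_measurable_continuous_onI
        continuous_on_norm continuous_on_grad_norm cf C1_fun_continuous_on[OF cf(1)]
        C1_fun_continuous_on[OF cf(2)])+
    define X where "X p h l = enn_Lp p (ball z (2 ^ (l + 1) * r)) h" for p h and l :: nat
    have mono: "mono (X p h)" if "p > 0" for p h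
    proof (rule monoI)
      fix k l :: nat assume "k \<le> l"
      then have "2 ^ (k + 1) * r \<le> 2 ^ (l + 1) * r" using r by (intro mult_right_mono power_increasing) auto
      then show "X p h k \<le> X p h l"
        unfolding X_def using that by (intro enn_Lp_mono subset_ball) auto
    qed
    define Z where "Z h h' = (\<Sum>l. ennreal (2 powr (- real l * (\<epsilon> - \<alpha>))) * (X p1 h l * X p2 h' l))" for h h'
    have prod: "enn_Lp q (ball z r) (\<lambda>x. potential b c z r h x * potential b' c' z r h' x)
      \<le> ennreal (D * D' * (2 * G) * r powr (2 * n - (1 - \<alpha>))) * Z h h'"
      if L: "Lbound D p1 q1 s1 b c" "Lbound D' p2 q2 s2 b' c'" and D: "D > 0" "D' > 0"
        and [measurable]: "h \<in> borel_measurable borel" "h' \<in> borel_measurable borel"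
      for D D' b c b' c' h h'
    proof -
      have "enn_Lp q (ball z r) (\<lambda>x. potential b c z r h x * potential b' c' z r h' x)
        \<le> enn_Lp q1 (ball z r) (potential b c z r h) * enn_Lp q2 (ball z r) (potential b' c' z r h')"
        using assms(7) q qq by (intro enn_Lp_mult_le) auto
      also have "\<dots> \<le> (ennreal (D * r powr (n - s1)) * W p1 z r h) * (ennreal (D' * r powr (n - s2)) * W p2 z r h')"
        using L r that(5,6) by (intro mult_mono) (simp_all add: Lbound_def)
      also have "\<dots> = ennreal (D * D' * (r powr (n - s1) * r powr (n - s2))) * (W p1 z r h * W p2 z r h')"
        using D by (simp add: ennreal_mult mult_ac)
      also have "W p1 z r h * W p2 z r h' \<le> 2 * (\<Sum>l. ennreal (2 powr (- real l * \<epsilon>))) *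
          (\<Sum>l. ennreal (2 powr (- real l * \<epsilon>)) * (X p1 h l * X p2 h' l))"
        unfolding W_def X_def[symmetric] using assms(5,6)
        by (intro ennreal_suminf_mult_suminf_le mono) auto
      \<comment> \<open>Since \<open>\<alpha> > 0\<close>, each weight
        \<open>2 powr (- l * \<epsilon>)\<close> is at most the weight
        \<open>2 powr (- l * (\<epsilon> - \<alpha>))\<close> of the claim.\<close>
      also have "\<dots> \<le> 2 * ennreal G * Z h h'"
      proof (intro mult_mono[OF mult_left_mono[OF weights]])
        show "(\<Sum>l. ennreal (2 powr (- real l * \<epsilon>)) * (X p1 h l * X p2 h' l)) \<le> Z h h'"
          unfolding Z_def using \<alpha>
          by (intro suminf_le mult_right_mono ennreal_leI powr_mono summableI) (auto intro!: mult_left_mono)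
      qed auto
      also have "r powr (n - s1) * r powr (n - s2) = r powr (2 * n - (1 - \<alpha>))"
        unfolding s(3)[symmetric] powr_add[symmetric] by (simp add: algebra_simps)
      also have "ennreal (D * D' * r powr (2 * n - (1 - \<alpha>))) * (2 * ennreal G * Z h h')
          = ennreal (D * D' * (2 * G) * r powr (2 * n - (1 - \<alpha>))) * Z h h'"
        using D G by (simp add: ennreal_mult mult_ac)
      finally show ?thesis by (simp add: mult_left_mono)
    qed
    define Q1 where "Q1 x = potential (n + \<delta>1 - 1) (N - 1) z r f1 x * potential (n - \<kappa>2) N z r g0 x" for x
    define Q2 where "Q2 x = potential (n - \<kappa>1) N z r f0 x * potential (n + \<delta>2 - 1) (N - 1) z r g1 x" for x
    have [measurable]: "Q1 \<in> borel_measurable borel" "Q2 \<in> borel_measurable borel"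
      unfolding Q1_def[abs_def] Q2_def[abs_def] by measurable
    \<comment> \<open>Only monotonicity is applied to the product error itself; the inequalities
      that need measurability concern the potentials alone.\<close>
    have "Lp_norm_on q (ball z r) (\<lambda>x. f x * g x - kernel_op (p (r powr m)) f x * kernel_op (p (r powr m)) g x)
      \<le> enn_Lp q (ball z r) (\<lambda>x. ennreal (C0 * r powr (1 - 2 * n)) * (Q1 x + Q2 x))"
      unfolding Lp_norm_on_eq_enn_Lp Q1_def Q2_def f0_def g0_def f1_def g1_def
      using assms(7) pointwise r adm by (intro enn_Lp_mono) blast+
    also have "\<dots> = ennreal (C0 * r powr (1 - 2 * n)) * enn_Lp q (ball z r) (\<lambda>x. Q1 x + Q2 x)"
      using assms(7) by (intro enn_Lp_cmult) auto
    also have "enn_Lp q (ball z r) (\<lambda>x. Q1 x + Q2 x)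
      \<le> ennreal (2 powr (1 + 1 / q)) * (enn_Lp q (ball z r) Q1 + enn_Lp q (ball z r) Q2)"
      using assms(7) by (intro enn_Lp_add_le) auto
    also have "enn_Lp q (ball z r) Q1 + enn_Lp q (ball z r) Q2
      \<le> ennreal (C1 * C2 * (2 * G) * r powr (2 * n - (1 - \<alpha>))) * Z f1 g0
       + ennreal (C3 * C4 * (2 * G) * r powr (2 * n - (1 - \<alpha>))) * Z f0 g1"
      unfolding Q1_def Q2_def using C1 C2 C3 C4 meas by (intro add_mono prod)
    also have "\<dots> \<le> ennreal (E * (2 * G) * r powr (2 * n - (1 - \<alpha>))) * Z f1 g0
       + ennreal (E * (2 * G) * r powr (2 * n - (1 - \<alpha>))) * Z f0 g1"
      using C1(1) C2(1) C3(1) C4(1) G by (intro add_mono mult_right_mono ennreal_leI) (auto simp: E_def)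
    also have "\<dots> = ennreal (E * (2 * G) * r powr (2 * n - (1 - \<alpha>))) * (Z f1 g0 + Z f0 g1)"
      by (simp only: distrib_left)
    also have "ennreal (C0 * r powr (1 - 2 * n)) * (ennreal (2 powr (1 + 1 / q)) *
        (ennreal (E * (2 * G) * r powr (2 * n - (1 - \<alpha>))) * (Z f1 g0 + Z f0 g1)))
      = ennreal (C * (r powr (1 - 2 * n) * r powr (2 * n - (1 - \<alpha>)))) * (Z f1 g0 + Z f0 g1)"
      using C0 E G by (simp add: C_def ennreal_mult mult_ac)
    \<comment> \<open>The pointwise estimate contributes \<open>1 - 2 * n\<close>, and the two
      potentials contribute \<open>2 * n - s1 - s2\<close>; what remains is
      \<open>1 - (s1 + s2) = \<alpha>\<close>.\<close>
    also have "r powr (1 - 2 * n) * r powr (2 * n - (1 - \<alpha>)) = r powr \<alpha>"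
      unfolding powr_add[symmetric] by simp
    also have "Z f1 g0 + Z f0 g1 = (\<Sum>l::nat. ennreal (2 powr (- real l * (\<epsilon> - \<alpha>))) *
        (X p1 f1 l * X p2 g0 l + X p1 f0 l * X p2 g1 l))"
      unfolding Z_def distrib_left by (intro suminf_add summableI)
    finally show ?thesis
      by (simp add: Lp_norm_on_eq_enn_Lp X_def f0_def[abs_def] g0_def[abs_def] f1_def[abs_def] g1_def[abs_def] mult_left_mono)
  qed
  then show ?thesis using C by (intro exI[of _ C] conjI allI impI)
qed

end
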